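(* Let $X$ be an integrable random variable, $N\sim\mathcal{N}(0,1)$ independent of $X$, $Y=X+N$, and $f(y)=\mathbb{E}[X\mid Y=y]$. Let $r\ge2$ be an integer, $q_r=\lfloor(\sqrt{8r+9}-3)/2\rfloor$ and $\gamma_r=((2rq_r)!)^{1/(4q_r)}$. Then $$\big\|f^{(r-1)}(Y)\big\|_{2}\le 2^rC_r\min\big(\gamma_r,\ \|X\|_{2rq_r}^r\big).$$
   Context: $f$ is the smooth version $f(y)=\mathbb{E}[Xe^{-(X-y)^2/2}]/\mathbb{E}[e^{-(X-y)^2/2}]$, and $\|Z\|_q=(\mathbb{E}|Z|^q)^{1/q}$. Let $\Pi_r$ be the set of integer partitions of $r$ into parts each $\ge2$, encoded by multiplicities $\boldsymbol{\lambda}=(\lambda_2,\dots,\lambda_\ell)$ with $2\lambda_2+\dots+\ell\lambda_\ell=r$; for such $\boldsymbol{\lambda}$ with $m=\lambda_2+\dots+\lambda_\ell$ parts, $c_{\boldsymbol{\lambda}}=\frac1m\binom{m}{\lambda_2,\dots,\lambda_\ell}\binom{r}{2,\dots,2;\dots;\ell,\dots,\ell}$ (the second multinomial has $\lambda_k$ entries equal to $k$ for each $k$), and $C_r=\sum_{\boldsymbol{\lambda}\in\Pi_r}c_{\boldsymbol{\lambda}}$. *)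

theory Defs
  imports "HOL-Probability.Probability"
begin

definition Lq_norm :: "'a measure \<Rightarrow> ('a \<Rightarrow> real) \<Rightarrow> real \<Rightarrow> ereal" where
  "Lq_norm M Z q =
     (if integrable M (\<lambda>\<omega>. \<bar>Z \<omega>\<bar> powr q)
      then ereal ((\<integral>\<omega>. \<bar>Z \<omega>\<bar> powr q \<partial>M) powr (1 / q))
      else \<infinity>)"

text \<open>Smooth version of the conditional mean \<open>E[X | X + N = y]\<close>.\<close>
definition cond_mean :: "'a measure \<Rightarrow> ('a \<Rightarrow> real) \<Rightarrow> real \<Rightarrow> real" where
  "cond_mean M X y =
     (\<integral>\<omega>. X \<omega> * exp (- (X \<omega> - y)\<^sup>2 / 2) \<partial>M) / (\<integral>\<omega>. exp (- (X \<omega> - y)\<^sup>2 / 2) \<partial>M)"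

text \<open>Partitions of r into parts \<ge> 2, encoded by multiplicity functions (\<open>lam k\<close> = number of parts equal to k).\<close>
definition partitions_ge2 :: "nat \<Rightarrow> (nat \<Rightarrow> nat) set" where
  "partitions_ge2 r = {lam. (\<forall>k. lam k \<noteq> 0 \<longrightarrow> 2 \<le> k \<and> k \<le> r) \<and> (\<Sum>k\<le>r. k * lam k) = r}"

definition part_coeff :: "nat \<Rightarrow> (nat \<Rightarrow> nat) \<Rightarrow> real" where
  "part_coeff r lam =
     (let m = (\<Sum>k\<le>r. lam k) in
      (1 / real m) * (fact m / (\<Prod>k\<le>r. fact (lam k)))
        * (fact r / (\<Prod>k\<le>r. (fact k) ^ (lam k))))"

definition C_const :: "nat \<Rightarrow> real" where
  "C_const r = (\<Sum>lam\<in>partitions_ge2 r. part_coeff r lam)"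

definition q_const :: "nat \<Rightarrow> nat" where
  "q_const r = nat \<lfloor>(sqrt (8 * real r + 9) - 3) / 2\<rfloor>"

definition gamma_const :: "nat \<Rightarrow> real" where
  "gamma_const r = (fact (2 * r * q_const r)) powr (1 / (4 * real (q_const r)))"

end

theory Submission
  imports Defs
begin

text \<open>The derivative \<open>f^(r-1)(y)\<close> is the \<open>r\<close>-th cumulant of the conditional law of \<open>X\<close> given \<open>Y = y\<close>.
  The moment-cumulant recursion for the central moments \<open>mu_k\<close> has the same shape as the recursion
  \<open>C_n = 1 + (\<Sum>k=2..<n. (n-1 choose k) * C_(n-k))\<close> satisfied by the sums over partitions; hence
  \<open>\<bar>mu_k\<bar> \<le> a^k\<close> for \<open>k \<le> r\<close> gives \<open>\<bar>f^(r-1)(y)\<bar> \<le> C_r * a^r\<close>. By Lyapunov's inequality for the conditional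
  law, one may take \<open>a^r = E[\<bar>X - f(Y)\<bar>^r | Y = y]\<close>, which is at most \<open>2^r * E[\<bar>X - c\<bar>^r | Y = y]\<close> for every
  \<open>c\<close>. Squaring and averaging over \<open>Y\<close> with \<open>c = 0\<close> gives the \<open>2r\<close>-th moment of \<open>X\<close>, and with \<open>c = y\<close>
  that of \<open>N\<close>. So the norm is bounded through \<open>2r\<close>-th moments only, and the exponent \<open>2 r q_r\<close> enters by
  monotonicity of the norms and by \<open>((2r)!)^q \<le> (2rq)!\<close>.\<close>

section \<open>A recursion for \<open>C_r\<close>\<close>

lemma finite_partitions_ge2: "finite (partitions_ge2 n)"
proof (rule finite_subset)
  show "partitions_ge2 n \<subseteq> {f. \<forall>x. (x \<in> {..n} \<longrightarrow> f x \<in> {..n}) \<and> (x \<notin> {..n} \<longrightarrow> f x = 0)}"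
  proof
    fix lam assume lam: "lam \<in> partitions_ge2 n"
    have "lam k \<le> n" if "k \<le> n" for k
    proof (cases "lam k = 0")
      case False
      hence "k \<ge> 2" using lam by (auto simp: partitions_ge2_def)
      \<comment> \<open>A part with \<open>k \<ge> 2\<close> contributes at least its multiplicity
        to the total \<open>n\<close>.\<close>
      hence "lam k \<le> k * lam k" by simp
      also have "\<dots> \<le> (\<Sum>k\<le>n. k * lam k)" using that by (intro member_le_sum) auto
      finally show ?thesis using lam by (auto simp: partitions_ge2_def)
    qed auto
    moreover have "lam k = 0" if "\<not> k \<le> n" for k using lam that by (auto simp: partitions_ge2_def)
    ultimately show "lam \<in> {f. \<forall>x. (x \<in> {..n} \<longrightarrow> f x \<in> {..n}) \<and> (x \<notin> {..n} \<longrightarrow> f x = 0)}" by auto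
  qed
  show "finite {f. \<forall>x. (x \<in> {..n} \<longrightarrow> f x \<in> {..n}) \<and> (x \<notin> {..n} \<longrightarrow> f x = (0::nat))}"
    by (rule finite_set_of_finite_funs) auto
qed

text \<open>\<open>part_weight N lam\<close> is \<open>part_coeff n lam / n!\<close>, with an index range \<open>N \<ge> n\<close> that may exceed
  \<open>n\<close>, so that partitions of different integers can be compared.\<close>
definition part_weight :: "nat \<Rightarrow> (nat \<Rightarrow> nat) \<Rightarrow> real" where
  "part_weight N lam = fact ((\<Sum>k\<le>N. lam k) - 1) / (\<Prod>k\<le>N. fact (lam k) * fact k ^ lam k)"

lemma partitions_ge2_sum_pos:
  assumes "lam \<in> partitions_ge2 n" "n > 0"
  shows "(\<Sum>k\<le>n. lam k) > 0"
proof (rule ccontr)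
  assume "\<not> ?thesis"
  hence "\<forall>k\<le>n. lam k = 0" by simp
  hence "(\<Sum>k\<le>n. k * lam k) = 0" by simp
  thus False using assms by (simp add: partitions_ge2_def del: sum_eq_0_iff)
qed

text \<open>The factor \<open>1 / m\<close> turns \<open>m!\<close> into \<open>(m - 1)!\<close>,
  and multiplicities beyond \<open>n\<close> vanish, so enlarging the index range only adds factors
  1.\<close>

lemma part_coeff_eq_weight:
  assumes "lam \<in> partitions_ge2 n" "0 < n" "n \<le> N"
  shows "part_coeff n lam = fact n * part_weight N lam"
proof -
  define m where "m = (\<Sum>k\<le>n. lam k)"
  have z: "lam k = 0" if "k \<in> {..N} - {..n}" for k
    using assms(1) that by (auto simp: partitions_ge2_def)
  have "(\<Sum>k\<le>N. lam k) = m" unfolding m_def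
    using assms z by (intro sum.mono_neutral_right) auto
  moreover have "(\<Prod>k\<le>N. fact (lam k) * fact k ^ lam k :: real) = (\<Prod>k\<le>n. fact (lam k) * fact k ^ lam k)"
    using assms z by (intro prod.mono_neutral_right) auto
  moreover have "m > 0" unfolding m_def using partitions_ge2_sum_pos assms by blast
  hence "fact m = real m * fact (m - 1)" by (simp add: fact_reduce)
  ultimately show ?thesis using \<open>m > 0\<close>
    by (simp add: part_coeff_def part_weight_def Let_def m_def[symmetric] prod.distrib)
qed

lemma C_const_eq_weight:
  assumes "0 < n" "n \<le> N"
  shows "C_const n = fact n * (\<Sum>lam\<in>partitions_ge2 n. part_weight N lam)"
  unfolding C_const_def sum_distrib_left
  using assms by (intro sum.cong refl part_coeff_eq_weight)

lemma sum_upd_remove_part: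
  fixes f :: "nat \<Rightarrow> nat \<Rightarrow> 'b::comm_monoid_add"
  assumes "finite A" "k \<in> A"
  shows "(\<Sum>i\<in>A. f i ((lam(k := v)) i)) = f k v + (\<Sum>i\<in>A - {k}. f i (lam i))"
  using assms by (subst sum.remove[of A k]) (auto intro!: sum.cong arg_cong2[where f="(+)"])

lemma prod_upd_remove_part:
  fixes f :: "nat \<Rightarrow> nat \<Rightarrow> 'b::comm_monoid_mult"
  assumes "finite A" "k \<in> A"
  shows "(\<Prod>i\<in>A. f i ((lam(k := v)) i)) = f k v * (\<Prod>i\<in>A - {k}. f i (lam i))"
  using assms by (subst prod.remove[of A k]) (auto intro!: prod.cong arg_cong2[where f="(*)"])

text \<open>Removing one copy of the part \<open>k\<close> is a bijection from the partitions of
  \<open>n\<close> that contain \<open>k\<close> onto the partitions of \<open>n - k\<close>; adding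
  a copy inverts it.\<close>

lemma sum_partitions_remove_part:
  fixes F :: "(nat \<Rightarrow> nat) \<Rightarrow> real"
  assumes "2 \<le> k" "k \<le> n"
  shows "(\<Sum>lam | lam \<in> partitions_ge2 n \<and> lam k \<ge> 1. F (lam(k := lam k - 1)))
       = (\<Sum>lam\<in>partitions_ge2 (n - k). F lam)"
proof (rule sum.reindex_bij_witness[where i = "\<lambda>mu. mu(k := Suc (mu k))" and j = "\<lambda>lam. lam(k := lam k - 1)"])
  fix lam assume "lam \<in> {lam. lam \<in> partitions_ge2 n \<and> lam k \<ge> 1}"
  hence lam: "lam \<in> partitions_ge2 n" "lam k \<ge> 1" by auto
  let ?mu = "lam(k := lam k - 1)"
  show "?mu(k := Suc (?mu k)) = lam" using lam by (auto simp: fun_eq_iff)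
  have "(\<Sum>i\<le>n. i * lam i) = k * lam k + (\<Sum>i\<in>{..n} - {k}. i * lam i)"
    using assms by (subst sum.remove[of _ k]) auto
  moreover have "(\<Sum>i\<le>n. i * ?mu i) = k * (lam k - 1) + (\<Sum>i\<in>{..n} - {k}. i * lam i)"
    using assms by (intro sum_upd_remove_part) auto
  moreover have "k * lam k = k + k * (lam k - 1)" using lam by (cases "lam k") auto
  ultimately have s: "(\<Sum>i\<le>n. i * ?mu i) = n - k"
    using lam by (auto simp: partitions_ge2_def)
  \<comment> \<open>A surviving part \<open>i\<close> contributes at least \<open>i\<close> to the
    remaining total \<open>n - k\<close>.\<close>
  have small: "i \<le> n - k" if "?mu i \<noteq> 0" for i
  proof -
    have "i \<le> n" using that lam assms by (auto simp: partitions_ge2_def split: if_splits)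
    have "i \<le> i * ?mu i" using that by auto
    also have "\<dots> \<le> (\<Sum>i\<le>n. i * ?mu i)" using \<open>i \<le> n\<close> by (intro member_le_sum) auto
    finally show ?thesis using s by simp
  qed
  have "(\<Sum>i\<le>n - k. i * ?mu i) = (\<Sum>i\<le>n. i * ?mu i)"
    using small by (intro sum.mono_neutral_left) fastforce+
  with s small lam assms show "?mu \<in> partitions_ge2 (n - k)"
    by (auto simp: partitions_ge2_def split: if_splits)
next
  fix mu assume mu: "mu \<in> partitions_ge2 (n - k)"
  let ?lam = "mu(k := Suc (mu k))"
  show "?lam(k := ?lam k - 1) = mu" by auto
  have "(\<Sum>i\<le>n. i * ?lam i) = k * Suc (mu k) + (\<Sum>i\<in>{..n} - {k}. i * mu i)"
    using assms by (intro sum_upd_remove_part) auto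
  also have "\<dots> = k + (\<Sum>i\<le>n. i * mu i)"
    using assms by (subst sum.remove[of "{..n}" k]) auto
  also have "(\<Sum>i\<le>n. i * mu i) = (\<Sum>i\<le>n - k. i * mu i)"
    using mu by (intro sum.mono_neutral_right) (auto simp: partitions_ge2_def)
  finally have "(\<Sum>i\<le>n. i * ?lam i) = n" using mu assms by (simp add: partitions_ge2_def)
  moreover have "2 \<le> i \<and> i \<le> n" if "?lam i \<noteq> 0" for i
  proof (cases "i = k")
    case False
    hence "2 \<le> i \<and> i \<le> n - k" using mu that by (simp add: partitions_ge2_def)
    thus ?thesis by linarith
  qed (use assms in simp)
  ultimately have "?lam \<in> partitions_ge2 n" unfolding partitions_ge2_def by blast
  thus "?lam \<in> {lam. lam \<in> partitions_ge2 n \<and> lam k \<ge> 1}" by simp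
qed simp

text \<open>With \<open>m\<close> parts in all, the removal turns \<open>(m - 1)!\<close> into
  \<open>(m - 2)!\<close> and cancels \<open>lam k * k!\<close> in the denominator. For
  \<open>m = 1\<close> the left side would be 0, hence the bound on the sum.\<close>

lemma part_weight_remove_part:
  assumes "lam k \<ge> 1" "k \<le> N" "(\<Sum>i\<le>N. lam i) \<ge> 2"
  shows "part_weight N (lam(k := lam k - 1)) / fact k * (real (\<Sum>i\<le>N. lam i) - 1)
       = real (lam k) * part_weight N lam"
proof -
  define R where "R = (\<Prod>i\<in>{..N} - {k}. fact (lam i) * fact i ^ lam i :: real)"
  define m where "m = (\<Sum>i\<le>N. lam i)"
  have R: "R > 0" unfolding R_def by (intro prod_pos) auto
  have m: "m = lam k + (\<Sum>i\<in>{..N} - {k}. lam i)"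
    unfolding m_def using assms by (subst sum.remove[of _ k]) auto
  have "(\<Sum>i\<le>N. (lam(k := lam k - 1)) i) = (lam k - 1) + (\<Sum>i\<in>{..N} - {k}. lam i)"
    using assms sum_upd_remove_part[of "{..N}" k "\<lambda>_ x. x"] by auto
  hence s: "(\<Sum>i\<le>N. (lam(k := lam k - 1)) i) = m - 1" using m assms by auto
  have p: "(\<Prod>i\<le>N. fact ((lam(k := lam k - 1)) i) * fact i ^ ((lam(k := lam k - 1)) i) :: real)
     = (fact (lam k - 1) * fact k ^ (lam k - 1)) * R"
    unfolding R_def using assms by (intro prod_upd_remove_part) auto
  have p': "(\<Prod>i\<le>N. fact (lam i) * fact i ^ lam i :: real) = (fact (lam k) * fact k ^ lam k) * R"
    unfolding R_def using assms by (subst prod.remove[of _ k]) auto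
  obtain a where a: "lam k = Suc a" using assms by (cases "lam k") auto
  obtain b where b: "m = Suc (Suc b)" using assms unfolding m_def[symmetric]
    by (metis Suc_le_D numeral_2_eq_2 le_Suc_eq)
  have w1: "part_weight N (lam(k := lam k - 1)) = fact b / (fact a * fact k ^ a * R)"
    unfolding part_weight_def s p by (simp add: a b)
  have w2: "part_weight N lam = fact (Suc b) / (fact (Suc a) * fact k ^ Suc a * R)"
    unfolding part_weight_def m_def[symmetric] p' by (simp add: a b)
  show ?thesis unfolding w1 w2 m_def[symmetric] unfolding a b
    using R by (simp add: divide_simps)
qed

text \<open>A part \<open>n\<close> already exhausts the total. The partitions of \<open>n\<close>
  thus split into the one-part partition and those with \<open>lam n = 0\<close>.\<close>

lemma partitions_ge2_largest:
  assumes "n \<ge> 2" "lam \<in> partitions_ge2 n" "lam n \<ge> 1"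
  shows "lam = (\<lambda>i. if i = n then 1 else 0)"
proof -
  have "(\<Sum>i\<le>n. i * lam i) = n * lam n + (\<Sum>i\<in>{..n} - {n}. i * lam i)"
    by (subst sum.remove[of _ n]) auto
  hence e: "n = n * lam n + (\<Sum>i\<in>{..n} - {n}. i * lam i)" using assms by (auto simp: partitions_ge2_def)
  obtain a where a: "lam n = Suc a" using assms by (cases "lam n") auto
  have "a = 0" "(\<Sum>i\<in>{..n} - {n}. i * lam i) = 0" using e assms unfolding a by auto
  hence "\<forall>i\<in>{..n} - {n}. i * lam i = 0" by simp
  moreover have "2 \<le> i \<and> i \<le> n" if "lam i \<noteq> 0" for i using assms that by (auto simp: partitions_ge2_def)
  ultimately have "lam i = 0" if "i \<noteq> n" for i
    using that by (metis DiffI atMost_iff mult_eq_0_iff not_numeral_le_zero singletonD)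
  thus ?thesis using a \<open>a = 0\<close> by (simp add: fun_eq_iff)
qed

lemma single_part_in_partitions_ge2:
  assumes "n \<ge> 2"
  shows "(\<lambda>i. if i = n then 1 else 0) \<in> partitions_ge2 n"
proof -
  have "(\<Sum>k\<le>n. k * (if k = n then 1 else 0)) = (\<Sum>k\<le>n. if k = n then n else 0)"
    by (intro sum.cong) auto
  thus ?thesis using assms by (simp add: partitions_ge2_def)
qed

lemma part_weight_single_part: "part_weight n (\<lambda>i. if i = n then 1 else 0) = 1 / fact n"
proof -
  have "fact (if k = n then 1 else 0) * fact k ^ (if k = n then 1 else 0) = (if k = n then fact n else 1 :: real)" for k
    by (cases "k = n") simp_all
  moreover have "(\<Sum>k\<le>n. if k = n then 1 else 0 :: nat) = 1" by simp
  moreover have "(\<Prod>k\<le>n. if k = n then fact n else 1 :: real) = fact n" by simp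
  ultimately show ?thesis unfolding part_weight_def by (simp only:) simp
qed

text \<open>Each part is removed in turn: the part \<open>k\<close> is weighted by \<open>n - k\<close>, and these weights add up to
  \<open>n * m - n\<close> over the \<open>m\<close> parts.\<close>
lemma part_weight_eq_sum_remove:
  assumes n: "n \<ge> 2" and lam: "lam \<in> partitions_ge2 n" "lam n = 0"
  shows "real n * part_weight n lam
    = (\<Sum>k | k \<in> {2..<n} \<and> lam k \<ge> 1. real (n - k) / fact k * part_weight n (lam(k := lam k - 1)))"
proof -
  define m where "m = (\<Sum>i\<le>n. lam i)"
  have sn: "(\<Sum>i\<le>n. i * lam i) = n" using lam by (auto simp: partitions_ge2_def)
  \<comment> \<open>Without the part \<open>n\<close> all parts are at most \<open>n - 1\<close>, so
    a single part cannot give the total \<open>n\<close>. The resulting \<open>m \<ge> 2\<close>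
    allows the final division by \<open>m - 1\<close>.\<close>
  have "(\<Sum>i\<le>n. i * lam i) \<le> (\<Sum>i\<le>n. (n - 1) * lam i)"
  proof (rule sum_mono)
    fix i assume "i \<in> {..n}"
    thus "i * lam i \<le> (n - 1) * lam i" using lam by (cases "i = n") auto
  qed
  hence "n \<le> (n - 1) * m" unfolding sn m_def sum_distrib_left .
  hence m: "m \<ge> 2" using n by (cases m; cases "m - 1") auto
  have "(real m - 1) * (\<Sum>k | k \<in> {2..<n} \<and> lam k \<ge> 1. real (n - k) / fact k * part_weight n (lam(k := lam k - 1)))
      = (\<Sum>k | k \<in> {2..<n} \<and> lam k \<ge> 1. real (n - k) * (part_weight n (lam(k := lam k - 1)) / fact k * (real m - 1)))"
    by (simp add: sum_distrib_left mult_ac)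
  also have "\<dots> = (\<Sum>k | k \<in> {2..<n} \<and> lam k \<ge> 1. real (n - k) * (real (lam k) * part_weight n lam))"
    unfolding m_def using m[unfolded m_def]
    by (intro sum.cong refl arg_cong2[where f="(*)"] part_weight_remove_part) auto
  also have "\<dots> = (\<Sum>k\<le>n. real (n - k) * (real (lam k) * part_weight n lam))"
    using lam by (intro sum.mono_neutral_left) (auto simp: partitions_ge2_def not_le)
  also have "\<dots> = (\<Sum>k\<le>n. (real n * real (lam k) - real (k * lam k)) * part_weight n lam)"
    by (intro sum.cong refl) (auto simp: of_nat_diff algebra_simps)
  also have "\<dots> = (real n * real m - real n) * part_weight n lam"
    unfolding m_def sum_distrib_right[symmetric] sum_subtractf sum_distrib_left[symmetric] of_nat_sum[symmetric] sn ..
  also have "\<dots> = (real m - 1) * (real n * part_weight n lam)" by (simp add: algebra_simps)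
  finally show ?thesis using m by simp
qed

text \<open>The one-part partition contributes the 1. For the others the removal identity is summed
  over all partitions and the two sums are exchanged; a fixed removed part \<open>k\<close> then
  leaves the partitions of \<open>n - k\<close>. The binomial coefficient appears when the weights
  are turned back into \<open>C_const (n - k)\<close>.\<close>

lemma C_const_rec:
  assumes n: "n \<ge> 2"
  shows "C_const n = 1 + (\<Sum>k=2..<n. real ((n - 1) choose k) * C_const (n - k))"
proof -
  let ?e = "\<lambda>i. if i = n then 1 else 0 :: nat"
  let ?Q = "{lam \<in> partitions_ge2 n. lam n = 0}"
  have fin: "finite ?Q" using finite_partitions_ge2 by auto
  have P: "partitions_ge2 n = insert ?e ?Q"
  proof -
    have "lam = ?e \<or> lam n = 0" if "lam \<in> partitions_ge2 n" for lam
      using partitions_ge2_largest[OF n that] by (cases "lam n") auto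
    thus ?thesis using single_part_in_partitions_ge2[OF n] by auto
  qed
  have "(\<Sum>lam\<in>?Q. real n * part_weight n lam)
      = (\<Sum>lam\<in>?Q. \<Sum>k | k \<in> {2..<n} \<and> lam k \<ge> 1. real (n - k) / fact k * part_weight n (lam(k := lam k - 1)))"
    by (intro sum.cong refl part_weight_eq_sum_remove) (use n in auto)
  also have "\<dots> = (\<Sum>k=2..<n. \<Sum>lam | lam \<in> ?Q \<and> lam k \<ge> 1. real (n - k) / fact k * part_weight n (lam(k := lam k - 1)))"
    using fin by (intro sum.swap_restrict) auto
  also have "\<dots> = (\<Sum>k=2..<n. real (n - k) / fact k * (\<Sum>lam\<in>partitions_ge2 (n - k). part_weight n lam))"
  proof (rule sum.cong[OF refl])
    fix k assume k: "k \<in> {2..<n}"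
    \<comment> \<open>A part \<open>k < n\<close> excludes the one-part partition, so
      \<open>lam n = 0\<close> holds automatically.\<close>
    have "{lam. lam \<in> ?Q \<and> lam k \<ge> 1} = {lam. lam \<in> partitions_ge2 n \<and> lam k \<ge> 1}"
      using partitions_ge2_largest[OF n] k by (auto simp: Suc_le_eq split: if_splits) (metis not_gr_zero order_less_irrefl)
    thus "(\<Sum>lam | lam \<in> ?Q \<and> lam k \<ge> 1. real (n - k) / fact k * part_weight n (lam(k := lam k - 1)))
       = real (n - k) / fact k * (\<Sum>lam\<in>partitions_ge2 (n - k). part_weight n lam)"
      using k sum_partitions_remove_part[of k n "part_weight n"] by (simp only: sum_distrib_left[symmetric]) auto
  qed
  also have "\<dots> = (\<Sum>k=2..<n. real n / fact n * (real ((n - 1) choose k) * C_const (n - k)))"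
  proof (rule sum.cong[OF refl])
    fix k assume k: "k \<in> {2..<n}"
    \<comment> \<open>\<open>j = n - k - 1\<close> is the complement of \<open>k\<close> in
      \<open>n - 1\<close>, and \<open>(n - k)! = (n - k) * j!\<close> absorbs the factor
      \<open>n - k\<close>.\<close>
    obtain j where j: "n - k = Suc j" "n = Suc (k + j)" using k by (metis Suc_diff_Suc add_Suc_right atLeastLessThan_iff le_add_diff_inverse less_or_eq_imp_le)
    define W where "W = (\<Sum>lam\<in>partitions_ge2 (n - k). part_weight n lam)"
    have "C_const (n - k) = fact (n - k) * W"
      unfolding W_def using k by (intro C_const_eq_weight) auto
    moreover have "real ((n - 1) choose k) = fact (n - 1) / (fact k * fact j)"
      using j by (simp add: binomial_fact)
    moreover have "fact (n - k) = real (n - k) * fact j" by (simp add: j(1))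
    moreover have "fact n = real n * fact (n - 1)" using n by (simp add: fact_reduce)
    ultimately show "real (n - k) / fact k * (\<Sum>lam\<in>partitions_ge2 (n - k). part_weight n lam)
      = real n / fact n * (real ((n - 1) choose k) * C_const (n - k))"
      unfolding W_def[symmetric] using n by simp
  qed
  finally have *: "(\<Sum>lam\<in>?Q. real n * part_weight n lam) =
     real n / fact n * (\<Sum>k=2..<n. real ((n - 1) choose k) * C_const (n - k))"
    by (simp add: sum_distrib_left)
  have "real n * C_const n = fact n * (\<Sum>lam\<in>partitions_ge2 n. real n * part_weight n lam)"
    using n by (subst C_const_eq_weight[of n n]) (auto simp: sum_distrib_left mult_ac)
  also have "\<dots> = fact n * (real n / fact n + (\<Sum>lam\<in>?Q. real n * part_weight n lam))"
    using fin by (subst P, subst sum.insert) (auto simp: part_weight_single_part)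
  also have "\<dots> = real n * (1 + (\<Sum>k=2..<n. real ((n - 1) choose k) * C_const (n - k)))"
    unfolding * by (simp add: field_simps)
  finally show ?thesis using n by simp
qed

section \<open>Cumulants bounded by central moments\<close>

lemma C_const_nonneg: "C_const n \<ge> 0"
  unfolding C_const_def part_coeff_def Let_def
  by (auto intro!: sum_nonneg mult_nonneg_nonneg divide_nonneg_nonneg prod_nonneg)

text \<open>\<open>kap n\<close> stands for the cumulant of order \<open>n + 1\<close>. In the
  recursion \<open>mu 0 = 1\<close> isolates \<open>kap n\<close>, and \<open>mu 1 = 0\<close> kills
  the term \<open>j = n - 1\<close>; bounding the rest inductively reproduces
  \<open>C_const_rec\<close> with every term scaled by \<open>a ^ Suc n\<close>.\<close>

lemma cumulant_bound:
  fixes kap mu :: "nat \<Rightarrow> real"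
  assumes rec: "\<And>n. n < r \<Longrightarrow> mu (Suc n) = (\<Sum>j\<le>n. real (n choose j) * kap j * mu (n - j))"
    and mu: "mu 0 = 1" "mu 1 = 0" "\<And>k. k \<le> r \<Longrightarrow> \<bar>mu k\<bar> \<le> a ^ k"
    and "a \<ge> 0" "n < r"
  shows "\<bar>kap n\<bar> \<le> a ^ Suc n * C_const (Suc n)"
  using \<open>n < r\<close>
proof (induction n rule: less_induct)
  case (less n)
  show ?case
  proof (cases n)
    case 0
    \<comment> \<open>The first cumulant equals \<open>mu 1 = 0\<close>, so a nonnegative right side
      suffices.\<close>
    thus ?thesis using rec[of 0] mu less.prems \<open>a \<ge> 0\<close> C_const_nonneg[of 1] by simp
  next
    case (Suc p)
    have "mu (Suc n) = kap n + (\<Sum>j<n. real (n choose j) * kap j * mu (n - j))"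
      using rec[OF less.prems] mu(1) by (simp add: lessThan_Suc_atMost[symmetric])
    also have "(\<Sum>j<n. real (n choose j) * kap j * mu (n - j)) = (\<Sum>j<p. real (n choose j) * kap j * mu (n - j))"
      using mu(2) by (simp add: Suc)
    finally have "\<bar>kap n\<bar> \<le> \<bar>mu (Suc n)\<bar> + \<bar>\<Sum>j<p. real (n choose j) * kap j * mu (n - j)\<bar>" by simp
    also have "\<dots> \<le> a ^ Suc n + (\<Sum>j<p. real (n choose j) * (a ^ Suc j * C_const (Suc j)) * a ^ (n - j))"
    proof (intro add_mono order.trans[OF sum_abs] sum_mono)
      show "\<bar>mu (Suc n)\<bar> \<le> a ^ Suc n" using less.prems by (intro mu(3)) auto
      fix j assume j: "j \<in> {..<p}"
      show "\<bar>real (n choose j) * kap j * mu (n - j)\<bar> \<le> real (n choose j) * (a ^ Suc j * C_const (Suc j)) * a ^ (n - j)"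
        unfolding abs_mult using j Suc less.prems \<open>a \<ge> 0\<close> C_const_nonneg
        by (intro mult_mono less.IH mu(3)) auto
    qed
    \<comment> \<open>Substituting \<open>k = n - j\<close> turns \<open>Suc n - k\<close> into
      \<open>Suc j\<close>; the range \<open>j < n - 1\<close> becomes
      \<open>2 \<le> k \<le> n\<close>.\<close>
    also have "(\<Sum>j<p. real (n choose j) * (a ^ Suc j * C_const (Suc j)) * a ^ (n - j))
        = (\<Sum>k=2..<Suc n. a ^ Suc n * (real (n choose k) * C_const (Suc n - k)))"
    proof (rule sum.reindex_bij_witness[where i = "\<lambda>k. n - k" and j = "\<lambda>j. n - j"])
      fix j assume "j \<in> {..<p}"
      hence j: "j \<le> n" "Suc n - (n - j) = Suc j" using Suc by auto
      have "a ^ Suc n = a ^ Suc j * a ^ (n - j)" using j by (metis add_Suc le_add_diff_inverse power_add)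
      moreover have "n choose (n - j) = n choose j" using j by (simp add: binomial_symmetric[symmetric])
      ultimately show "a ^ Suc n * (real (n choose (n - j)) * C_const (Suc n - (n - j)))
          = real (n choose j) * (a ^ Suc j * C_const (Suc j)) * a ^ (n - j)"
        unfolding j(2) by (simp only: mult_ac)
    qed (use Suc in auto)
    also have "a ^ Suc n + \<dots> = a ^ Suc n * C_const (Suc n)"
      using Suc by (subst C_const_rec) (auto simp: sum_distrib_left algebra_simps)
    finally show ?thesis .
  qed
qed

section \<open>Derivatives of the conditional mean\<close>

text \<open>The mean value inequality bounds the difference quotients by \<open>B\<close>, so
  dominated convergence along an arbitrary null sequence moves the limit inside the
  integral.\<close>

lemma has_real_derivative_integral_dominated:
  fixes h h' :: "real \<Rightarrow> 'a \<Rightarrow> real" and M :: "'a measure"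
  assumes d: "d > 0"
    and int: "\<And>t. \<bar>t - y\<bar> < d \<Longrightarrow> integrable M (h t)"
    and meas: "h' y \<in> borel_measurable M"
    and deriv: "\<And>t \<omega>. \<bar>t - y\<bar> < d \<Longrightarrow> ((\<lambda>t. h t \<omega>) has_real_derivative h' t \<omega>) (at t)"
    and bound: "\<And>t \<omega>. \<bar>t - y\<bar> < d \<Longrightarrow> \<bar>h' t \<omega>\<bar> \<le> B \<omega>"
    and B: "integrable M B"
  shows "((\<lambda>t. \<integral>\<omega>. h t \<omega> \<partial>M) has_real_derivative (\<integral>\<omega>. h' y \<omega> \<partial>M)) (at y)"
  unfolding DERIV_def tendsto_at_iff_sequentially
proof safe
  fix e :: "nat \<Rightarrow> real" assume ne: "\<forall>i. e i \<in> UNIV - {0}" and lim: "e \<longlonglongrightarrow> 0"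
  from lim d have "eventually (\<lambda>i. \<bar>e i\<bar> < d) sequentially"
    by (auto simp: tendsto_iff dist_real_def)
  \<comment> \<open>Only quotients with \<open>\<bar>e n\<bar> < d\<close> are controlled, so the
    sequence is shifted by \<open>n0\<close>; \<open>LIMSEQ_offset\<close> undoes the shift at the
    end.\<close>
  then obtain n0 where n0: "\<And>n. n \<ge> n0 \<Longrightarrow> \<bar>e n\<bar> < d" by (auto simp: eventually_sequentially)
  let ?s = "\<lambda>n \<omega>. (h (y + e (n + n0)) \<omega> - h y \<omega>) / e (n + n0)"
  have [measurable]: "h t \<in> borel_measurable M" if "\<bar>t - y\<bar> < d" for t
    using int[OF that] by auto
  have e_lim: "filterlim (\<lambda>n. e (n + n0)) (at 0) sequentially"
    using LIMSEQ_ignore_initial_segment[OF lim, of n0] ne by (auto simp: filterlim_at)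
  have "(\<lambda>n. \<integral>\<omega>. ?s n \<omega> \<partial>M) \<longlonglongrightarrow> (\<integral>\<omega>. h' y \<omega> \<partial>M)"
  proof (rule integral_dominated_convergence)
    show "?s n \<in> borel_measurable M" for n
      using n0[of "n + n0"] d by (intro borel_measurable_divide borel_measurable_diff) auto
    show "AE \<omega> in M. (\<lambda>n. ?s n \<omega>) \<longlonglongrightarrow> h' y \<omega>"
    proof (rule AE_I2)
      fix \<omega>
      have "((\<lambda>e. (h (y + e) \<omega> - h y \<omega>) / e) \<longlongrightarrow> h' y \<omega>) (at 0)"
        using deriv[of y \<omega>] d by (simp add: DERIV_def)
      thus "(\<lambda>n. ?s n \<omega>) \<longlonglongrightarrow> h' y \<omega>" by (rule filterlim_compose[OF _ e_lim])
    qed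
    show "AE \<omega> in M. norm (?s n \<omega>) \<le> B \<omega>" for n
    proof (rule AE_I2)
      fix \<omega>
      let ?S = "{y - \<bar>e (n + n0)\<bar>..y + \<bar>e (n + n0)\<bar>}"
      have "norm (h (y + e (n + n0)) \<omega> - h y \<omega>) \<le> B \<omega> * norm (y + e (n + n0) - y)"
      proof (rule field_differentiable_bound[of ?S "\<lambda>t. h t \<omega>" "\<lambda>t. h' t \<omega>"])
        fix t assume "t \<in> ?S"
        hence t: "\<bar>t - y\<bar> < d" using n0[of "n + n0"] by auto
        show "((\<lambda>t. h t \<omega>) has_field_derivative h' t \<omega>) (at t within ?S)"
          using deriv[OF t] by (rule has_field_derivative_at_within)
        show "norm (h' t \<omega>) \<le> B \<omega>" using bound[OF t] by simp
      qed auto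
      thus "norm (?s n \<omega>) \<le> B \<omega>" using ne by (simp add: divide_simps)
    qed
  qed fact+
  also have "(\<lambda>n. \<integral>\<omega>. ?s n \<omega> \<partial>M) =
      (\<lambda>n. ((\<integral>\<omega>. h (y + e (n + n0)) \<omega> \<partial>M) - (\<integral>\<omega>. h y \<omega> \<partial>M)) / e (n + n0))"
  proof
    fix n
    show "(\<integral>\<omega>. ?s n \<omega> \<partial>M) = ((\<integral>\<omega>. h (y + e (n + n0)) \<omega> \<partial>M) - (\<integral>\<omega>. h y \<omega> \<partial>M)) / e (n + n0)"
      using int[of "y + e (n + n0)"] int[of y] n0[of "n + n0"] d by simp
  qed
  finally show "((\<lambda>h'. ((\<integral>\<omega>. h (y + h') \<omega> \<partial>M) - (\<integral>\<omega>. h y \<omega> \<partial>M)) / h') \<circ> e) \<longlonglongrightarrow> (\<integral>\<omega>. h' y \<omega> \<partial>M)"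
    unfolding comp_def by (rule LIMSEQ_offset)
qed

text \<open>The bound depends on \<open>v\<close> only through \<open>R\<close>, which makes it a
  dominating constant for differentiation in the observation. One term of the exponential series
  gives \<open>\<bar>u\<bar>^k \<le> k! * exp \<bar>u\<bar>\<close>, and the Gaussian absorbs the
  exponential.\<close>

lemma power_mult_gaussian_le:
  fixes u v R :: real
  assumes "\<bar>v\<bar> \<le> R"
  shows "\<bar>u ^ k * exp (- (u - v)\<^sup>2 / 2)\<bar> \<le> fact k * exp (1 + R\<^sup>2)"
proof -
  have "\<bar>u\<bar> ^ k / fact k \<le> exp \<bar>u\<bar>"
  proof -
    have "(\<Sum>n\<in>{k}. \<bar>u\<bar> ^ n /\<^sub>R fact n) \<le> exp \<bar>u\<bar>"
      unfolding exp_def by (intro sum_le_suminf summable_exp_generic) auto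
    thus ?thesis by (simp add: field_simps)
  qed
  hence "\<bar>u\<bar> ^ k * exp (- (u - v)\<^sup>2 / 2) \<le> fact k * (exp \<bar>u\<bar> * exp (- (u - v)\<^sup>2 / 2))"
    by (simp add: field_simps)
  also have "exp \<bar>u\<bar> * exp (- (u - v)\<^sup>2 / 2) = exp (\<bar>u\<bar> - (u - v)\<^sup>2 / 2)"
    by (simp flip: exp_add)
  also have "\<bar>u\<bar> - (u - v)\<^sup>2 / 2 \<le> 1 + R\<^sup>2"
  proof -
    \<comment> \<open>The two squares add up to
      \<open>u * v + \<bar>u\<bar> \<le> u^2 / 2 + v^2 + 1\<close>, so the exponent is at most
      \<open>1 + v^2 / 2\<close>.\<close>
    have "(u / 2 - v)\<^sup>2 \<ge> 0" "(\<bar>u\<bar> / 2 - 1)\<^sup>2 \<ge> 0" by simp_all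
    moreover have "v\<^sup>2 \<le> R\<^sup>2" using assms by (metis abs_ge_zero power2_abs power_mono)
    moreover have "R\<^sup>2 \<ge> 0" by simp
    moreover have "(u / 2 - v)\<^sup>2 = u\<^sup>2 / 4 - u * v + v\<^sup>2" "(\<bar>u\<bar> / 2 - 1)\<^sup>2 = u\<^sup>2 / 4 - \<bar>u\<bar> + 1"
      "(u - v)\<^sup>2 = u\<^sup>2 - 2 * (u * v) + v\<^sup>2"
      by (simp_all add: power2_diff power_divide)
    ultimately show ?thesis by linarith
  qed
  finally show ?thesis by (simp add: abs_mult power_abs)
qed

section \<open>Posterior moments as functions of the observation\<close>

locale gaussian_posterior = prob_space M for M :: "'a measure" +
  fixes X :: "'a \<Rightarrow> real"
  assumes X_measurable [measurable]: "X \<in> borel_measurable M"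
begin

text \<open>\<open>post c k y\<close> is \<open>E[(X - c)^k | Y = y]\<close>; the factor \<open>1 / sqrt (2 * pi)\<close> of the normal density
  cancels and is left out of \<open>mom\<close>.\<close>
definition mom :: "real \<Rightarrow> nat \<Rightarrow> real \<Rightarrow> real" where
  "mom c k y = (\<integral>\<omega>. (X \<omega> - c) ^ k * exp (- (X \<omega> - y)\<^sup>2 / 2) \<partial>M)"

definition post :: "real \<Rightarrow> nat \<Rightarrow> real \<Rightarrow> real" where
  "post c k y = mom c k y / mom c 0 y"

text \<open>With \<open>u = X - c\<close> and \<open>v = y - c\<close> the Gaussian factor makes the
  integrand bounded, so posterior moments of all orders exist.\<close>

lemma integrable_mom: "integrable M (\<lambda>\<omega>. (X \<omega> - c) ^ k * exp (- (X \<omega> - y)\<^sup>2 / 2))"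
proof (rule integrable_const_bound)
  show "AE \<omega> in M. norm ((X \<omega> - c) ^ k * exp (- (X \<omega> - y)\<^sup>2 / 2)) \<le> fact k * exp (1 + (y - c)\<^sup>2)"
    using power_mult_gaussian_le[of "y - c" "\<bar>y - c\<bar>" "X _ - c" k] by simp
qed simp

lemma mom_0_eq: "mom c 0 y = mom 0 0 y"
  by (simp add: mom_def)

lemma mom_0_pos: "mom c 0 y > 0"
proof -
  have i: "integrable M (\<lambda>\<omega>. exp (- (X \<omega> - y)\<^sup>2 / 2))" using integrable_mom[of c 0 y] by simp
  have "mom c 0 y \<ge> 0" by (simp add: mom_def)
  moreover have "mom c 0 y \<noteq> 0"
    using integral_nonneg_eq_0_iff_AE[OF i] AE_False by (simp add: mom_def)
  ultimately show ?thesis by simp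
qed

text \<open>Differentiating the kernel brings down \<open>X - y = (X - c) + (c - y)\<close>: the
  first summand raises the order of the moment, the second only rescales it.\<close>

lemma mom_has_derivative:
  "(mom c k has_real_derivative mom c (Suc k) y + (c - y) * mom c k y) (at y)"
proof -
  let ?h = "\<lambda>t \<omega>. (X \<omega> - c) ^ k * exp (- (X \<omega> - t)\<^sup>2 / 2)"
  let ?h' = "\<lambda>t \<omega>. (X \<omega> - c) ^ Suc k * exp (- (X \<omega> - t)\<^sup>2 / 2) + (c - t) * ?h t \<omega>"
  \<comment> \<open>\<open>R\<close> dominates \<open>\<bar>t - c\<bar>\<close> for all
    \<open>t\<close> within distance 1 of \<open>y\<close>, so one constant \<open>B\<close> serves
    the whole neighbourhood.\<close>
  define R where "R = \<bar>y - c\<bar> + 1"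
  define B :: real where "B = fact (Suc k) * exp (1 + R\<^sup>2) + R * (fact k * exp (1 + R\<^sup>2))"
  have "((\<lambda>t. \<integral>\<omega>. ?h t \<omega> \<partial>M) has_real_derivative (\<integral>\<omega>. ?h' y \<omega> \<partial>M)) (at y)"
  proof (rule has_real_derivative_integral_dominated[where d = 1 and B = "\<lambda>_. B"])
    show "((\<lambda>t. ?h t \<omega>) has_real_derivative ?h' t \<omega>) (at t)" for t \<omega>
      by (auto intro!: derivative_eq_intros simp: field_simps)
    fix t \<omega> assume "\<bar>t - y\<bar> < 1"
    hence t: "\<bar>t - c\<bar> \<le> R" unfolding R_def by linarith
    hence "\<bar>(c - t) * ?h t \<omega>\<bar> \<le> R * (fact k * exp (1 + R\<^sup>2))"
      unfolding abs_mult[of "c - t"]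
      using power_mult_gaussian_le[OF t, of "X \<omega> - c" k] by (intro mult_mono) auto
    moreover have "\<bar>(X \<omega> - c) ^ Suc k * exp (- (X \<omega> - t)\<^sup>2 / 2)\<bar> \<le> fact (Suc k) * exp (1 + R\<^sup>2)"
      using power_mult_gaussian_le[OF t, of "X \<omega> - c" "Suc k"] by simp
    ultimately show "\<bar>?h' t \<omega>\<bar> \<le> B" unfolding B_def by linarith
  qed (use integrable_mom in auto)
  also have "(\<integral>\<omega>. ?h' y \<omega> \<partial>M) = mom c (Suc k) y + (c - y) * mom c k y"
    unfolding mom_def using integrable_mom[of c "Suc k" y] integrable_mom[of c k y] by simp
  finally show ?thesis unfolding mom_def[abs_def] .
qed

text \<open>In the quotient rule the two \<open>c - y\<close> terms cancel. What remains is the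
  posterior covariance of \<open>(X - c)^k\<close> and \<open>X\<close>.\<close>

lemma post_has_derivative:
  "(post c k has_real_derivative post c (Suc k) y - post c k y * post c 1 y) (at y)"
proof -
  have "((\<lambda>y. mom c k y / mom c 0 y) has_real_derivative
      ((mom c (Suc k) y + (c - y) * mom c k y) * mom c 0 y
        - mom c k y * (mom c (Suc 0) y + (c - y) * mom c 0 y)) / (mom c 0 y * mom c 0 y)) (at y)"
    using mom_0_pos[of c y] by (intro DERIV_divide mom_has_derivative) auto
  also have "((mom c (Suc k) y + (c - y) * mom c k y) * mom c 0 y
        - mom c k y * (mom c (Suc 0) y + (c - y) * mom c 0 y)) / (mom c 0 y * mom c 0 y)
      = post c (Suc k) y - post c k y * post c 1 y"
    using mom_0_pos[of c y] by (simp add: post_def field_simps)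
  finally show ?thesis by (simp add: post_def[abs_def])
qed

lemma post_0 [simp]: "post c 0 y = 1"
  using mom_0_pos[of c y] by (simp add: post_def)

lemma post_1_eq_cond_mean: "post c 1 y = cond_mean M X y - c"
proof -
  have "mom c 1 y = mom 0 1 y - c * mom 0 0 y"
    using integrable_mom[of 0 1 y] integrable_mom[of 0 0 y]
    by (simp add: mom_def left_diff_distrib)
  moreover have "cond_mean M X y = mom 0 1 y / mom 0 0 y"
    by (simp add: cond_mean_def mom_def)
  ultimately show ?thesis
    using mom_0_pos[of 0 y] by (simp add: post_def mom_0_eq[of c] field_simps)
qed

text \<open>The \<open>j\<close>-th derivative of the conditional mean is the \<open>(j + 1)\<close>-st cumulant of the posterior
  distribution; this is the moment-cumulant recursion, obtained by differentiating it in \<open>y\<close>.\<close>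
lemma post_Suc_eq_sum_deriv:
  "(\<forall>y. post c (Suc n) y = (\<Sum>j\<le>n. real (n choose j) * (deriv ^^ j) (post c 1) y * post c (n - j) y))
   \<and> (\<forall>j\<le>n. \<forall>y. (deriv ^^ j) (post c 1) differentiable at y)"
proof (induction n)
  case 0
  have "post c 1 differentiable at y" for y
    using post_has_derivative real_differentiable_def by blast
  thus ?case by simp
next
  case (Suc n)
  let ?k = "\<lambda>j. (deriv ^^ j) (post c 1)"
  have D: "(?k j has_real_derivative ?k (Suc j) y) (at y)" if "j \<le> n" for j y
    using Suc.IH that by (simp add: DERIV_deriv_iff_real_differentiable)
  have rec: "post c (Suc (Suc n)) y = (\<Sum>j\<le>Suc n. real (Suc n choose j) * ?k j y * post c (Suc n - j) y)" for y
  proof -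
    have eq: "post c (Suc n) = (\<lambda>y. \<Sum>j\<le>n. real (n choose j) * ?k j y * post c (n - j) y)"
      using Suc.IH by auto
    have "((\<lambda>y. \<Sum>j\<le>n. real (n choose j) * ?k j y * post c (n - j) y) has_real_derivative
       (\<Sum>j\<le>n. real (n choose j) * (?k (Suc j) y * post c (n - j) y
          + (post c (Suc (n - j)) y - post c (n - j) y * post c 1 y) * ?k j y))) (at y)"
      unfolding mult.assoc
      by (intro DERIV_sum DERIV_cmult DERIV_mult D post_has_derivative) auto
    hence "post c (Suc (Suc n)) y - post c (Suc n) y * post c 1 y = 
       (\<Sum>j\<le>n. real (n choose j) * (?k (Suc j) y * post c (n - j) y
          + (post c (Suc (n - j)) y - post c (n - j) y * post c 1 y) * ?k j y))"
      unfolding eq[symmetric] by (rule DERIV_unique[OF post_has_derivative])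
    also have "\<dots> = (\<Sum>j\<le>n. real (n choose j) * ?k (Suc j) y * post c (n - j) y)
         + (\<Sum>j\<le>n. real (n choose j) * ?k j y * post c (Suc n - j) y)
         - (\<Sum>j\<le>n. real (n choose j) * ?k j y * post c (n - j) y) * post c 1 y"
      unfolding sum_distrib_right sum.distrib[symmetric] sum_subtractf[symmetric]
      by (intro sum.cong refl) (simp add: Suc_diff_le algebra_simps)
    \<comment> \<open>By the induction hypothesis the subtracted sum is again
      \<open>post c (Suc n) y\<close>, so its product with \<open>post c 1 y\<close> cancels on both
      sides.\<close>
    also have "(\<Sum>j\<le>n. real (n choose j) * ?k j y * post c (n - j) y) = post c (Suc n) y"
      using Suc.IH by simp
    finally have "post c (Suc (Suc n)) y =
        (\<Sum>j\<le>n. real (n choose j) * ?k (Suc j) y * post c (n - j) y)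
         + (\<Sum>j\<le>n. real (n choose j) * ?k j y * post c (Suc n - j) y)" by simp
    \<comment> \<open>The added term \<open>j = Suc n\<close> has binomial coefficient 0; it aligns
      the ranges for the index shift and Pascal's rule.\<close>
    also have "(\<Sum>j\<le>n. real (n choose j) * ?k j y * post c (Suc n - j) y)
        = (\<Sum>j\<le>Suc n. real (n choose j) * ?k j y * post c (Suc n - j) y)" by simp
    also have "\<dots> = ?k 0 y * post c (Suc n) y
        + (\<Sum>j\<le>n. real (n choose Suc j) * ?k (Suc j) y * post c (n - j) y)"
      by (subst sum.atMost_Suc_shift) simp
    also have "(\<Sum>j\<le>n. real (n choose j) * ?k (Suc j) y * post c (n - j) y) + \<dots>
        = ?k 0 y * post c (Suc n) y
        + (\<Sum>j\<le>n. real (Suc n choose Suc j) * ?k (Suc j) y * post c (n - j) y)"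
      by (simp add: sum.distrib[symmetric] algebra_simps)
    also have "\<dots> = (\<Sum>j\<le>Suc n. real (Suc n choose j) * ?k j y * post c (Suc n - j) y)"
      unfolding sum.atMost_Suc_shift by simp
    finally show ?thesis .
  qed
  moreover have "?k (Suc n) differentiable at y" for y
  proof -
    \<comment> \<open>The top derivative enters the recursion with coefficient
      \<open>post c 0 y = 1\<close>, so it is expressed through posterior moments and lower
      derivatives, all differentiable.\<close>
    have eq: "?k (Suc n) = (\<lambda>y. post c (Suc (Suc n)) y - (\<Sum>j\<le>n. real (Suc n choose j) * ?k j y * post c (Suc n - j) y))"
      by (rule ext) (subst rec, simp)
    have "post c i differentiable at y" for i
      using post_has_derivative real_differentiable_def by blast
    thus ?thesis using Suc.IH unfolding eq
      by (intro derivative_intros differentiable_sum ballI) auto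
  qed
  ultimately show ?case using Suc.IH by (auto simp: le_Suc_eq)
qed

text \<open>Derivatives of positive order do not see the constant \<open>c\<close> by which
  \<open>post c 1\<close> differs from the conditional mean. This allows centring at a
  \<open>c\<close> chosen afterwards, in particular at the conditional mean for one fixed
  \<open>y\<close>.\<close>

lemma deriv_cond_mean_eq:
  assumes "j > 0"
  shows "(deriv ^^ j) (cond_mean M X) = (deriv ^^ j) (post c 1)"
proof -
  have p: "post c' 1 differentiable at y" for c' y
    using post_has_derivative real_differentiable_def by blast
  have f: "cond_mean M X = post 0 1" using post_1_eq_cond_mean[of 0] by (simp add: fun_eq_iff)
  have "deriv (post c 1) y = deriv (cond_mean M X) y" for y
  proof -
    have "post c 1 = (\<lambda>y. cond_mean M X y - c)" by (rule ext) (rule post_1_eq_cond_mean)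
    moreover have "(cond_mean M X has_real_derivative deriv (cond_mean M X) y) (at y)"
      using p unfolding f by (simp add: DERIV_deriv_iff_real_differentiable)
    ultimately have "(post c 1 has_real_derivative deriv (cond_mean M X) y) (at y)"
      by (auto intro!: derivative_eq_intros)
    thus ?thesis by (rule DERIV_imp_deriv)
  qed
  hence "deriv (post c 1) = deriv (cond_mean M X)" by blast
  moreover obtain i where "j = Suc i" using assms by (cases j) auto
  ultimately show ?thesis by (simp add: funpow_Suc_right del: funpow.simps)
qed

lemma deriv_cond_mean_measurable [measurable]: "(deriv ^^ j) (cond_mean M X) \<in> borel_measurable borel"
proof -
  have f: "cond_mean M X = post 0 1" using post_1_eq_cond_mean[of 0] by (simp add: fun_eq_iff)
  have "continuous_on UNIV ((deriv ^^ j) (post 0 1))"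
    using post_Suc_eq_sum_deriv[of 0 j]
    by (auto intro!: continuous_at_imp_continuous_on differentiable_imp_continuous_within)
  thus ?thesis unfolding f by (rule borel_measurable_continuous_onI)
qed

end

section \<open>Conditional moment bounds\<close>

text \<open>Young's inequality for \<open>t^r\<close> and 1 with weights \<open>k/r\<close> and
  \<open>1 - k/r\<close>: the concave function \<open>s^(k/r)\<close> of \<open>s = t^r\<close> lies
  below its tangent at \<open>s = 1\<close>.\<close>

lemma power_le_weighted_power:
  fixes t :: real
  assumes "t \<ge> 0" "k \<le> r" "r > 0"
  shows "t ^ k \<le> 1 + real k / real r * (t ^ r - 1)"
proof (cases "t = 0")
  case True
  thus ?thesis using assms by (cases "k = 0") (auto simp: zero_power field_simps)
next
  case False
  hence t: "t > 0" using assms by simp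
  have "(t ^ r) powr (real k / real r) * 1 powr (1 - real k / real r)
      \<le> real k / real r * t ^ r + (1 - real k / real r) * 1"
    using assms t by (intro Youngs_inequality_0) (auto simp: field_simps)
  moreover have "(t ^ r) powr (real k / real r) = t ^ k"
    using assms t by (simp add: powr_realpow[symmetric] powr_powr)
  ultimately show ?thesis by (simp add: right_diff_distrib)
qed

section \<open>Lyapunov's and Jensen's inequalities, and recentring of moments\<close>

context prob_space begin

lemma integrable_power_mono:
  fixes Z :: "'a \<Rightarrow> real"
  assumes [measurable]: "Z \<in> borel_measurable M" and int: "integrable M (\<lambda>\<omega>. \<bar>Z \<omega>\<bar> ^ r)" and "k \<le> r"
  shows "integrable M (\<lambda>\<omega>. \<bar>Z \<omega>\<bar> ^ k)"
proof (rule Bochner_Integration.integrable_bound)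
  show "integrable M (\<lambda>\<omega>. 1 + \<bar>Z \<omega>\<bar> ^ r)" using int by simp
  have "\<bar>z\<bar> ^ k \<le> 1 + \<bar>z\<bar> ^ r" for z :: real
  proof (cases "\<bar>z\<bar> \<le> 1")
    case True
    hence "\<bar>z\<bar> ^ k \<le> 1" by (simp add: power_le_one)
    thus ?thesis by (simp add: add_increasing2)
  next
    case False
    hence "\<bar>z\<bar> ^ k \<le> \<bar>z\<bar> ^ r" using \<open>k \<le> r\<close> by (intro power_increasing) auto
    thus ?thesis by simp
  qed
  thus "AE \<omega> in M. norm (\<bar>Z \<omega>\<bar> ^ k) \<le> norm (1 + \<bar>Z \<omega>\<bar> ^ r)" by simp
qed simp

text \<open>Lyapunov's inequality, with \<open>a\<close> any upper bound for the norm of order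
  \<open>r\<close>: the tangent inequality is applied to \<open>\<bar>Z\<bar> / b\<close> and
  integrated. Taking \<open>b > a\<close> and letting \<open>b\<close> tend to \<open>a\<close>
  avoids division by zero when \<open>a = 0\<close>.\<close>

lemma moment_le_power:
  fixes Z :: "'a \<Rightarrow> real"
  assumes Z [measurable]: "Z \<in> borel_measurable M" and int: "integrable M (\<lambda>\<omega>. \<bar>Z \<omega>\<bar> ^ r)"
    and a: "a \<ge> 0" "expectation (\<lambda>\<omega>. \<bar>Z \<omega>\<bar> ^ r) \<le> a ^ r" and k: "k \<le> r" "r > 0"
  shows "expectation (\<lambda>\<omega>. \<bar>Z \<omega>\<bar> ^ k) \<le> a ^ k"
proof -
  note intk = integrable_power_mono[OF Z int k(1)]
  have *: "expectation (\<lambda>\<omega>. \<bar>Z \<omega>\<bar> ^ k) \<le> b ^ k" if b: "b > a" for b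
  proof -
    have b0: "b > 0" using a b by simp
    have "expectation (\<lambda>\<omega>. \<bar>Z \<omega>\<bar> ^ k) / b ^ k = expectation (\<lambda>\<omega>. \<bar>Z \<omega>\<bar> ^ k / b ^ k)" by simp
    also have "\<dots> \<le> expectation (\<lambda>\<omega>. 1 + real k / real r * (\<bar>Z \<omega>\<bar> ^ r / b ^ r - 1))"
    proof (rule integral_mono)
      show "\<bar>Z \<omega>\<bar> ^ k / b ^ k \<le> 1 + real k / real r * (\<bar>Z \<omega>\<bar> ^ r / b ^ r - 1)" for \<omega>
        using power_le_weighted_power[of "\<bar>Z \<omega>\<bar> / b" k r] b0 k by (simp add: power_divide)
    qed (use int intk in auto)
    also have "\<dots> = 1 + real k / real r * (expectation (\<lambda>\<omega>. \<bar>Z \<omega>\<bar> ^ r) / b ^ r - 1)"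
      using int by (simp add: prob_space)
    also have "\<dots> \<le> 1 + real k / real r * (1 - 1)"
    proof (intro add_left_mono mult_left_mono diff_right_mono)
      have "a ^ r \<le> b ^ r" using a b by (intro power_mono) auto
      hence "expectation (\<lambda>\<omega>. \<bar>Z \<omega>\<bar> ^ r) \<le> b ^ r" using a by simp
      thus "expectation (\<lambda>\<omega>. \<bar>Z \<omega>\<bar> ^ r) / b ^ r \<le> 1" using b0 by simp
    qed simp
    finally show ?thesis using b0 by (simp add: field_simps)
  qed
  show ?thesis
  proof (rule tendsto_lowerbound)
    show "((\<lambda>b. b ^ k) \<longlongrightarrow> a ^ k) (at_right a)" by (intro tendsto_intros)
    show "eventually (\<lambda>b. expectation (\<lambda>\<omega>. \<bar>Z \<omega>\<bar> ^ k) \<le> b ^ k) (at_right a)"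
      using eventually_at_right_less[of a] by eventually_elim (rule *)
  qed simp
qed

text \<open>Jensen's inequality for the \<open>m\<close>-th power, obtained from Lyapunov's with
  \<open>a\<close> the norm of order \<open>k * m\<close>.\<close>

lemma expectation_power_le:
  fixes Z :: "'a \<Rightarrow> real"
  assumes Z: "Z \<in> borel_measurable M" and int: "integrable M (\<lambda>\<omega>. \<bar>Z \<omega>\<bar> ^ (k * m))" and "m > 0"
  shows "(expectation (\<lambda>\<omega>. \<bar>Z \<omega>\<bar> ^ k)) ^ m \<le> expectation (\<lambda>\<omega>. \<bar>Z \<omega>\<bar> ^ (k * m))"
proof (cases "k = 0")
  case True
  thus ?thesis by (simp add: prob_space)
next
  case False
  define a where "a = root (k * m) (expectation (\<lambda>\<omega>. \<bar>Z \<omega>\<bar> ^ (k * m)))"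
  have E: "expectation (\<lambda>\<omega>. \<bar>Z \<omega>\<bar> ^ (k * m)) \<ge> 0" by simp
  have a: "a ^ (k * m) = expectation (\<lambda>\<omega>. \<bar>Z \<omega>\<bar> ^ (k * m))" "a \<ge> 0"
    unfolding a_def using False \<open>m > 0\<close> by (auto intro!: real_root_pow_pos2)
  have "expectation (\<lambda>\<omega>. \<bar>Z \<omega>\<bar> ^ k) \<le> a ^ k"
    by (rule moment_le_power[OF Z int]) (use False \<open>m > 0\<close> a in auto)
  hence "(expectation (\<lambda>\<omega>. \<bar>Z \<omega>\<bar> ^ k)) ^ m \<le> (a ^ k) ^ m" by (intro power_mono) auto
  thus ?thesis using a by (simp add: power_mult)
qed

text \<open>The triangle inequality through \<open>c\<close> splits the deviation from the mean into
  two terms. Convexity of the power costs \<open>2 ^ (r - 1)\<close> for each, and Jensen bounds the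
  distance from the mean to \<open>c\<close> by the same moment as the other term.\<close>

lemma central_moment_le:
  fixes Z :: "'a \<Rightarrow> real"
  assumes Z [measurable]: "Z \<in> borel_measurable M" and int: "\<And>c. integrable M (\<lambda>\<omega>. \<bar>Z \<omega> - c\<bar> ^ r)" and "r > 0"
  shows "expectation (\<lambda>\<omega>. \<bar>Z \<omega> - expectation Z\<bar> ^ r) \<le> 2 ^ r * expectation (\<lambda>\<omega>. \<bar>Z \<omega> - c\<bar> ^ r)"
proof -
  let ?f = "expectation Z"
  have int1: "integrable M (\<lambda>\<omega>. \<bar>Z \<omega> - c\<bar>)" for c
    using integrable_power_mono[of "\<lambda>\<omega>. Z \<omega> - c" r 1] int[of c] \<open>r > 0\<close> by simp
  have intZ: "integrable M Z" using int1[of 0] by (simp add: integrable_abs_iff)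
  have "\<bar>?f - c\<bar> = \<bar>expectation (\<lambda>\<omega>. Z \<omega> - c)\<bar>" using intZ by (simp add: prob_space)
  also have "\<dots> \<le> expectation (\<lambda>\<omega>. \<bar>Z \<omega> - c\<bar>)" by (rule integral_abs_bound)
  finally have "\<bar>?f - c\<bar> ^ r \<le> (expectation (\<lambda>\<omega>. \<bar>Z \<omega> - c\<bar>)) ^ r" by (intro power_mono) auto
  also have "\<dots> \<le> expectation (\<lambda>\<omega>. \<bar>Z \<omega> - c\<bar> ^ r)"
    using expectation_power_le[of "\<lambda>\<omega>. Z \<omega> - c" 1 r] int[of c] \<open>r > 0\<close> by simp
  finally have f: "\<bar>?f - c\<bar> ^ r \<le> expectation (\<lambda>\<omega>. \<bar>Z \<omega> - c\<bar> ^ r)" .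
  have pw: "\<bar>z - ?f\<bar> ^ r \<le> 2 ^ r * ((\<bar>z - c\<bar> ^ r + \<bar>?f - c\<bar> ^ r) / 2)" for z
  proof -
    let ?u = "\<bar>z - c\<bar>" and ?v = "\<bar>?f - c\<bar>"
    \<comment> \<open>Restricting to the half line covers odd \<open>r\<close> as well; the
      inequality is then used at the midpoint.\<close>
    have "convex_on {0::real..} (\<lambda>x. x ^ r)"
      by (cases "even r") (auto intro: convex_power_odd convex_on_subset[OF convex_power_even])
    hence "((1 - 1 / 2) *\<^sub>R ?u + (1 / 2) *\<^sub>R ?v) ^ r \<le> (1 - 1 / 2) * ?u ^ r + (1 / 2) * ?v ^ r"
      by (rule convex_onD) auto
    hence "((?u + ?v) / 2) ^ r \<le> (?u ^ r + ?v ^ r) / 2" by (simp add: field_simps)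
    hence "(?u + ?v) ^ r \<le> 2 ^ r * ((?u ^ r + ?v ^ r) / 2)" by (simp add: power_divide field_simps)
    moreover have "\<bar>z - ?f\<bar> ^ r \<le> (?u + ?v) ^ r" by (intro power_mono) auto
    ultimately show ?thesis by linarith
  qed
  have "expectation (\<lambda>\<omega>. \<bar>Z \<omega> - ?f\<bar> ^ r) \<le> expectation (\<lambda>\<omega>. 2 ^ r * ((\<bar>Z \<omega> - c\<bar> ^ r + \<bar>?f - c\<bar> ^ r) / 2))"
    using int pw by (intro integral_mono) auto
  also have "\<dots> = 2 ^ r * ((expectation (\<lambda>\<omega>. \<bar>Z \<omega> - c\<bar> ^ r) + \<bar>?f - c\<bar> ^ r) / 2)"
    using int by (simp add: prob_space)
  also have "\<dots> \<le> 2 ^ r * expectation (\<lambda>\<omega>. \<bar>Z \<omega> - c\<bar> ^ r)" using f by (intro mult_left_mono) auto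
  finally show ?thesis .
qed

end

section \<open>The posterior law and the pointwise derivative bound\<close>

context gaussian_posterior begin

text \<open>Bayes' formula realises the conditional law of \<open>X\<close> given
  \<open>Y = y\<close> as a reweighting of \<open>M\<close>. Since \<open>X\<close> stays the random
  variable, the inequalities for expectations apply with \<open>posterior y\<close> in place of
  \<open>M\<close>.\<close>

definition posterior :: "real \<Rightarrow> 'a measure" where
  "posterior y = density M (\<lambda>\<omega>. ennreal (exp (- (X \<omega> - y)\<^sup>2 / 2) / mom 0 0 y))"

lemma prob_space_posterior: "prob_space (posterior y)"
proof
  have pos: "mom 0 0 y > 0" by (rule mom_0_pos)
  have "emeasure (posterior y) (space (posterior y))
      = (\<integral>\<^sup>+\<omega>. ennreal (exp (- (X \<omega> - y)\<^sup>2 / 2) / mom 0 0 y) \<partial>M)"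
    unfolding posterior_def by (simp add: emeasure_density cong: nn_integral_cong)
  also have "\<dots> = ennreal (\<integral>\<omega>. exp (- (X \<omega> - y)\<^sup>2 / 2) / mom 0 0 y \<partial>M)"
    using integrable_mom[of 0 0 y] pos by (intro nn_integral_eq_integral) auto
  also have "(\<integral>\<omega>. exp (- (X \<omega> - y)\<^sup>2 / 2) / mom 0 0 y \<partial>M) = 1"
    using pos by (simp add: mom_def)
  finally show "emeasure (posterior y) (space (posterior y)) = 1" by simp
qed

lemma measurable_posterior [simp]: "borel_measurable (posterior y) = borel_measurable M"
  unfolding posterior_def by (rule measurable_cong_sets) simp_all

lemma posterior_moments:
  shows integrable_posterior: "integrable (posterior y) (\<lambda>\<omega>. (X \<omega> - c) ^ k)"
    and integral_posterior: "(\<integral>\<omega>. (X \<omega> - c) ^ k \<partial>posterior y) = post c k y"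
proof -
  have pos: "mom 0 0 y > 0" by (rule mom_0_pos)
  have "integrable M (\<lambda>\<omega>. (X \<omega> - c) ^ k * exp (- (X \<omega> - y)\<^sup>2 / 2) / mom 0 0 y)"
    using integrable_mom by (rule integrable_divide)
  thus "integrable (posterior y) (\<lambda>\<omega>. (X \<omega> - c) ^ k)"
    unfolding posterior_def using pos by (subst integrable_real_density) (auto simp: mult_ac)
  have "(\<integral>\<omega>. (X \<omega> - c) ^ k \<partial>posterior y)
      = (\<integral>\<omega>. (X \<omega> - c) ^ k * exp (- (X \<omega> - y)\<^sup>2 / 2) / mom 0 0 y \<partial>M)"
    unfolding posterior_def using pos by (subst integral_real_density) (auto simp: mult_ac)
  thus "(\<integral>\<omega>. (X \<omega> - c) ^ k \<partial>posterior y) = post c k y"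
    by (simp add: post_def mom_0_eq[of c] mom_def)
qed

lemma integrable_posterior_abs: "integrable (posterior y) (\<lambda>\<omega>. \<bar>X \<omega> - c\<bar> ^ k)"
  using integrable_abs[OF integrable_posterior[of y c k]] by (simp add: power_abs)

lemma cond_mean_eq_integral_posterior: "cond_mean M X y = (\<integral>\<omega>. X \<omega> \<partial>posterior y)"
  using integral_posterior[of y 0 1] post_1_eq_cond_mean[of 0 y] by simp

lemma deriv_cond_mean_bound:
  assumes "r \<ge> 2"
  shows "\<bar>(deriv ^^ (r - 1)) (cond_mean M X) y\<bar>
    \<le> C_const r * (\<integral>\<omega>. \<bar>X \<omega> - cond_mean M X y\<bar> ^ r \<partial>posterior y)"
proof -
  interpret Q: prob_space "posterior y" by (rule prob_space_posterior)
  \<comment> \<open>\<open>c\<close> is a fixed number: derivatives treat it as a constant, and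
    \<open>post c 1\<close> vanishes at this particular \<open>y\<close>.\<close>
  define c where "c = cond_mean M X y"
  define A where "A = (\<integral>\<omega>. \<bar>X \<omega> - c\<bar> ^ r \<partial>posterior y)"
  define a where "a = root r A"
  have "A \<ge> 0" unfolding A_def by simp
  hence a: "a \<ge> 0" "a ^ r = A" unfolding a_def using assms by (auto intro!: real_root_pow_pos2)
  have "\<bar>(deriv ^^ (r - 1)) (post c 1) y\<bar> \<le> a ^ Suc (r - 1) * C_const (Suc (r - 1))"
  proof (rule cumulant_bound[where mu = "\<lambda>k. post c k y" and r = r])
    show "post c (Suc n) y = (\<Sum>j\<le>n. real (n choose j) * (deriv ^^ j) (post c 1) y * post c (n - j) y)" for n
      using post_Suc_eq_sum_deriv[of c n] by blast
    show "post c 1 y = 0" by (simp only: post_1_eq_cond_mean c_def diff_self)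
    show "\<bar>post c k y\<bar> \<le> a ^ k" if "k \<le> r" for k
    proof -
      have "\<bar>post c k y\<bar> \<le> (\<integral>\<omega>. \<bar>X \<omega> - c\<bar> ^ k \<partial>posterior y)"
        unfolding integral_posterior[symmetric] power_abs[symmetric] by (rule integral_abs_bound)
      also have "\<dots> \<le> a ^ k"
        by (rule Q.moment_le_power[where r = r])
          (use assms that a integrable_posterior_abs in \<open>auto simp: A_def\<close>)
      finally show ?thesis .
    qed
  qed (use a assms in auto)
  also have "Suc (r - 1) = r" using assms by simp
  finally show ?thesis using a assms deriv_cond_mean_eq[of "r - 1" c] by (simp add: A_def c_def mult.commute)
qed

text \<open>After recentring, Jensen moves the square inside the posterior expectation. The centre
  \<open>c\<close> is arbitrary, so it may later depend on \<open>y\<close>.\<close>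

lemma deriv_cond_mean_square_bound:
  assumes "r \<ge> 2"
  shows "((deriv ^^ (r - 1)) (cond_mean M X) y)\<^sup>2
    \<le> (C_const r * 2 ^ r)\<^sup>2 * (\<integral>\<omega>. \<bar>X \<omega> - c\<bar> ^ (2 * r) \<partial>posterior y)"
proof -
  interpret Q: prob_space "posterior y" by (rule prob_space_posterior)
  let ?A = "\<integral>\<omega>. \<bar>X \<omega> - c\<bar> ^ r \<partial>posterior y"
  have "\<bar>(deriv ^^ (r - 1)) (cond_mean M X) y\<bar>
      \<le> C_const r * (\<integral>\<omega>. \<bar>X \<omega> - cond_mean M X y\<bar> ^ r \<partial>posterior y)"
    by (rule deriv_cond_mean_bound[OF assms])
  also have "\<dots> \<le> C_const r * (2 ^ r * ?A)"
    unfolding cond_mean_eq_integral_posterior using assms integrable_posterior_abs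
    by (intro mult_left_mono Q.central_moment_le C_const_nonneg) auto
  finally have "\<bar>(deriv ^^ (r - 1)) (cond_mean M X) y\<bar>\<^sup>2 \<le> (C_const r * (2 ^ r * ?A))\<^sup>2"
    by (intro power_mono) auto
  also have "\<dots> = (C_const r * 2 ^ r)\<^sup>2 * ?A ^ 2" by (simp add: power_mult_distrib)
  also have "\<dots> \<le> (C_const r * 2 ^ r)\<^sup>2 * (\<integral>\<omega>. \<bar>X \<omega> - c\<bar> ^ (r * 2) \<partial>posterior y)"
    using integrable_posterior_abs by (intro mult_left_mono Q.expectation_power_le) auto
  finally show ?thesis by (simp add: mult.commute[of r 2])
qed

end

section \<open>Averaging over the channel output\<close>

locale gaussian_channel = gaussian_posterior M X for M :: "'a measure" and X :: "'a \<Rightarrow> real" +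
  fixes N :: "'a \<Rightarrow> real"
  assumes N_distributed: "distributed M lborel N std_normal_density"
    and indep: "indep_var borel X borel N"
begin

lemma N_measurable [measurable]: "N \<in> borel_measurable M"
  using distributed_measurable[OF N_distributed] by simp

text \<open>Independence makes the joint law of \<open>X\<close> and \<open>N\<close> a product;
  Tonelli and the translation \<open>y = x + n\<close> turn the noise density into the conditional
  density of the output given \<open>X = x\<close>.\<close>

lemma nn_integral_channel:
  assumes [measurable]: "g \<in> borel_measurable (borel \<Otimes>\<^sub>M borel)"
  shows "(\<integral>\<^sup>+\<omega>. g (X \<omega>, X \<omega> + N \<omega>) \<partial>M)
    = (\<integral>\<^sup>+\<omega>. (\<integral>\<^sup>+y. g (X \<omega>, y) * ennreal (std_normal_density (y - X \<omega>)) \<partial>lborel) \<partial>M)"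
proof -
  let ?PX = "distr M borel X" and ?PN = "distr M borel N"
  interpret PN: prob_space ?PN by (rule prob_space_distr) simp
  have PN: "?PN = density lborel (\<lambda>x. ennreal (std_normal_density x))"
    using distributed_distr_eq_density[OF N_distributed] by (metis distr_cong sets_lborel)
  have joint: "distr M (borel \<Otimes>\<^sub>M borel) (\<lambda>\<omega>. (X \<omega>, N \<omega>)) = ?PX \<Otimes>\<^sub>M ?PN"
    using indep unfolding indep_var_distribution_eq by simp
  have inner: "(\<integral>\<^sup>+n. g (x, x + n) \<partial>?PN) = (\<integral>\<^sup>+y. g (x, y) * ennreal (std_normal_density (y - x)) \<partial>lborel)" for x
  proof -
    have "(\<integral>\<^sup>+n. g (x, x + n) \<partial>?PN) = (\<integral>\<^sup>+n. g (x, x + n) * ennreal (std_normal_density n) \<partial>lborel)"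
      unfolding PN by (subst nn_integral_density) (auto simp: mult.commute)
    also have "\<dots> = (\<integral>\<^sup>+y. g (x, y) * ennreal (std_normal_density (y - x)) \<partial>lborel)"
      by (subst nn_integral_real_affine[where c = 1 and t = x]) auto
    finally show ?thesis .
  qed
  have "(\<integral>\<^sup>+\<omega>. g (X \<omega>, X \<omega> + N \<omega>) \<partial>M)
      = (\<integral>\<^sup>+p. g (fst p, fst p + snd p) \<partial>distr M (borel \<Otimes>\<^sub>M borel) (\<lambda>\<omega>. (X \<omega>, N \<omega>)))"
    by (subst nn_integral_distr) auto
  also have "\<dots> = (\<integral>\<^sup>+x. \<integral>\<^sup>+n. g (x, x + n) \<partial>?PN \<partial>?PX)"
    unfolding joint by (subst PN.nn_integral_fst[symmetric]) auto
  also have "\<dots> = (\<integral>\<^sup>+\<omega>. (\<integral>\<^sup>+n. g (X \<omega>, X \<omega> + n) \<partial>?PN) \<partial>M)"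
    by (subst nn_integral_distr) auto
  finally show ?thesis unfolding inner .
qed

lemma mom_0_measurable [measurable]: "mom 0 0 \<in> borel_measurable borel"
  using mom_has_derivative[of 0 0]
  by (intro borel_measurable_continuous_onI continuous_at_imp_continuous_on) (blast intro: DERIV_isCont)

lemma std_normal_density_shift:
  "std_normal_density (y - x) = exp (- (x - y)\<^sup>2 / 2) / sqrt (2 * pi)" for x y :: real
  by (simp add: std_normal_density_def power2_commute)

text \<open>The tower property \<open>E[E[g(X,Y) | Y]] = E[g(X,Y)]\<close>. Posterior weight times
  output density is the density of the output given \<open>X\<close>, and Tonelli permits both
  exchanges of integrals.\<close>

lemma nn_integral_posterior:
  assumes [measurable]: "g \<in> borel_measurable (borel \<Otimes>\<^sub>M borel)"
  shows "(\<integral>\<^sup>+\<omega>. (\<integral>\<^sup>+\<omega>'. g (X \<omega>', X \<omega> + N \<omega>) \<partial>posterior (X \<omega> + N \<omega>)) \<partial>M)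
    = (\<integral>\<^sup>+\<omega>. g (X \<omega>, X \<omega> + N \<omega>) \<partial>M)"
proof -
  interpret P: pair_sigma_finite M lborel ..
  define H where "H y = (\<integral>\<^sup>+\<omega>'. g (X \<omega>', y) * ennreal (exp (- (X \<omega>' - y)\<^sup>2 / 2) / mom 0 0 y) \<partial>M)" for y
  have H [measurable]: "H \<in> borel_measurable borel" unfolding H_def by measurable
  have post: "(\<integral>\<^sup>+\<omega>'. g (X \<omega>', y) \<partial>posterior y) = H y" for y
    unfolding posterior_def H_def by (subst nn_integral_density) (auto simp: mult.commute)
  \<comment> \<open>This is the density of the output \<open>X + N\<close> at
    \<open>y\<close>.\<close>
  have dens: "(\<integral>\<^sup>+\<omega>. ennreal (std_normal_density (y - X \<omega>)) \<partial>M) = ennreal (mom 0 0 y / sqrt (2 * pi))" for y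
  proof -
    have "integrable M (\<lambda>\<omega>. exp (- (X \<omega> - y)\<^sup>2 / 2))" using integrable_mom[of 0 0 y] by simp
    hence "(\<integral>\<^sup>+\<omega>. ennreal (std_normal_density (y - X \<omega>)) \<partial>M)
        = ennreal (\<integral>\<omega>. exp (- (X \<omega> - y)\<^sup>2 / 2) / sqrt (2 * pi) \<partial>M)"
      unfolding std_normal_density_shift by (intro nn_integral_eq_integral) auto
    thus ?thesis by (simp add: mom_def)
  qed
  have "(\<integral>\<^sup>+\<omega>. H (X \<omega> + N \<omega>) \<partial>M)
      = (\<integral>\<^sup>+\<omega>. (\<integral>\<^sup>+y. H y * ennreal (std_normal_density (y - X \<omega>)) \<partial>lborel) \<partial>M)"
    using nn_integral_channel[of "\<lambda>p. H (snd p)"] by simp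
  also have "\<dots> = (\<integral>\<^sup>+y. (\<integral>\<^sup>+\<omega>. H y * ennreal (std_normal_density (y - X \<omega>)) \<partial>M) \<partial>lborel)"
    by (rule P.Fubini'[symmetric]) measurable
  also have "\<dots> = (\<integral>\<^sup>+y. (\<integral>\<^sup>+\<omega>. g (X \<omega>, y) * ennreal (std_normal_density (y - X \<omega>)) \<partial>M) \<partial>lborel)"
  proof (rule nn_integral_cong)
    fix y
    have pos: "mom 0 0 y > 0" by (rule mom_0_pos)
    have "(\<integral>\<^sup>+\<omega>. H y * ennreal (std_normal_density (y - X \<omega>)) \<partial>M) = H y * ennreal (mom 0 0 y / sqrt (2 * pi))"
      by (subst nn_integral_cmult) (auto simp: dens)
    also have "\<dots> = (\<integral>\<^sup>+\<omega>. g (X \<omega>, y) * ennreal (exp (- (X \<omega> - y)\<^sup>2 / 2) / mom 0 0 y) * ennreal (mom 0 0 y / sqrt (2 * pi)) \<partial>M)"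
      unfolding H_def by (subst nn_integral_multc) auto
    \<comment> \<open>The normalisation \<open>mom 0 0 y\<close> of the posterior cancels against
      the output density.\<close>
    also have "\<dots> = (\<integral>\<^sup>+\<omega>. g (X \<omega>, y) * ennreal (std_normal_density (y - X \<omega>)) \<partial>M)"
      unfolding std_normal_density_shift mult.assoc using pos
      by (intro nn_integral_cong arg_cong2[where f = "(*)"]) (auto simp: ennreal_mult[symmetric])
    finally show "(\<integral>\<^sup>+\<omega>. H y * ennreal (std_normal_density (y - X \<omega>)) \<partial>M)
        = (\<integral>\<^sup>+\<omega>. g (X \<omega>, y) * ennreal (std_normal_density (y - X \<omega>)) \<partial>M)" .
  qed
  also have "\<dots> = (\<integral>\<^sup>+\<omega>. (\<integral>\<^sup>+y. g (X \<omega>, y) * ennreal (std_normal_density (y - X \<omega>)) \<partial>lborel) \<partial>M)"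
    by (rule P.Fubini') measurable
  also have "\<dots> = (\<integral>\<^sup>+\<omega>. g (X \<omega>, X \<omega> + N \<omega>) \<partial>M)"
    by (rule nn_integral_channel[symmetric]) fact
  finally show ?thesis unfolding post .
qed

text \<open>The centre is a function of the output so that both choices are covered:
  \<open>\<lambda>_. 0\<close> leaves a moment of \<open>X\<close>, and \<open>\<lambda>y. y\<close>
  leaves one of \<open>X - (X + N) = - N\<close>.\<close>

lemma nn_integral_deriv_cond_mean_square_le:
  assumes r: "r \<ge> 2" and [measurable]: "c \<in> borel_measurable borel"
  shows "(\<integral>\<^sup>+\<omega>. ennreal (((deriv ^^ (r - 1)) (cond_mean M X) (X \<omega> + N \<omega>))\<^sup>2) \<partial>M)
    \<le> ennreal ((C_const r * 2 ^ r)\<^sup>2) * (\<integral>\<^sup>+\<omega>. ennreal (\<bar>X \<omega> - c (X \<omega> + N \<omega>)\<bar> ^ (2 * r)) \<partial>M)"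
proof -
  let ?g = "\<lambda>p. ennreal ((C_const r * 2 ^ r)\<^sup>2) * ennreal (\<bar>fst p - c (snd p)\<bar> ^ (2 * r))"
  have le: "ennreal (((deriv ^^ (r - 1)) (cond_mean M X) y)\<^sup>2) \<le> (\<integral>\<^sup>+\<omega>'. ?g (X \<omega>', y) \<partial>posterior y)" for y
  proof -
    have "ennreal (((deriv ^^ (r - 1)) (cond_mean M X) y)\<^sup>2)
       \<le> ennreal ((C_const r * 2 ^ r)\<^sup>2 * (\<integral>\<omega>. \<bar>X \<omega> - c y\<bar> ^ (2 * r) \<partial>posterior y))"
      by (intro ennreal_leI deriv_cond_mean_square_bound r)
    also have "\<dots> = ennreal ((C_const r * 2 ^ r)\<^sup>2) * ennreal (\<integral>\<omega>. \<bar>X \<omega> - c y\<bar> ^ (2 * r) \<partial>posterior y)"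
      by (rule ennreal_mult) auto
    also have "ennreal (\<integral>\<omega>. \<bar>X \<omega> - c y\<bar> ^ (2 * r) \<partial>posterior y) = (\<integral>\<^sup>+\<omega>. ennreal (\<bar>X \<omega> - c y\<bar> ^ (2 * r)) \<partial>posterior y)"
      using integrable_posterior_abs by (intro nn_integral_eq_integral[symmetric]) auto
    also have "ennreal ((C_const r * 2 ^ r)\<^sup>2) * \<dots> = (\<integral>\<^sup>+\<omega>'. ?g (X \<omega>', y) \<partial>posterior y)"
      by (subst nn_integral_cmult) auto
    finally show ?thesis .
  qed
  have "(\<integral>\<^sup>+\<omega>. ennreal (((deriv ^^ (r - 1)) (cond_mean M X) (X \<omega> + N \<omega>))\<^sup>2) \<partial>M)
     \<le> (\<integral>\<^sup>+\<omega>. (\<integral>\<^sup>+\<omega>'. ?g (X \<omega>', X \<omega> + N \<omega>) \<partial>posterior (X \<omega> + N \<omega>)) \<partial>M)"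
    by (intro nn_integral_mono le)
  also have "\<dots> = (\<integral>\<^sup>+\<omega>. ?g (X \<omega>, X \<omega> + N \<omega>) \<partial>M)"
    by (rule nn_integral_posterior) measurable
  also have "\<dots> = ennreal ((C_const r * 2 ^ r)\<^sup>2) * (\<integral>\<^sup>+\<omega>. ennreal (\<bar>X \<omega> - c (X \<omega> + N \<omega>)\<bar> ^ (2 * r)) \<partial>M)"
    by (subst nn_integral_cmult) auto
  finally show ?thesis .
qed

text \<open>The right side is the double factorial \<open>(2r - 1)!!\<close>.\<close>

lemma nn_integral_noise_moment:
  "(\<integral>\<^sup>+\<omega>. ennreal (\<bar>N \<omega>\<bar> ^ (2 * r)) \<partial>M) = ennreal (fact (2 * r) / (2 ^ r * fact r))"
proof -
  have m: "has_bochner_integral lborel (\<lambda>x. std_normal_density x * x ^ (2 * r)) (fact (2 * r) / (2 ^ r * fact r))"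
    using normal_moment_even[of 1 0 r] by simp
  have "(\<integral>\<^sup>+\<omega>. ennreal (\<bar>N \<omega>\<bar> ^ (2 * r)) \<partial>M)
      = (\<integral>\<^sup>+x. ennreal (std_normal_density x) * ennreal (\<bar>x\<bar> ^ (2 * r)) \<partial>lborel)"
    by (rule distributed_nn_integral[OF N_distributed, symmetric]) measurable
  also have "\<dots> = (\<integral>\<^sup>+x. ennreal (std_normal_density x * x ^ (2 * r)) \<partial>lborel)"
    by (intro nn_integral_cong) (simp add: ennreal_mult[symmetric] power_even_abs)
  also have "\<dots> = ennreal (fact (2 * r) / (2 ^ r * fact r))"
    using m by (subst nn_integral_eq_integral) (auto simp: has_bochner_integral_iff)
  finally show ?thesis .
qed

end

section \<open>Estimates for the factorial constants\<close>

lemma fact_double_le: "fact (2 * r) \<le> (2 ^ r * fact r :: real)\<^sup>2"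
proof (induction r)
  case (Suc r)
  have "fact (2 * Suc r) = (2 * real r + 2) * (2 * real r + 1) * (fact (2 * r) :: real)"
    by (simp add: algebra_simps)
  \<comment> \<open>\<open>2^r * r!\<close> is the double factorial \<open>(2r)!!\<close>; each odd
    factor is bounded by the next even one.\<close>
  also have "\<dots> \<le> (2 * real r + 2)\<^sup>2 * (2 ^ r * fact r)\<^sup>2"
    using Suc.IH by (intro mult_mono) (auto simp: power2_eq_square algebra_simps)
  also have "\<dots> = ((2 * real r + 2) * (2 ^ r * fact r))\<^sup>2" by (simp only: power_mult_distrib)
  also have "(2 * real r + 2) * (2 ^ r * fact r) = 2 ^ Suc r * fact (Suc r)"
    by (simp add: algebra_simps)
  finally show ?case .
qed simp

text \<open>The quotient of the two sides is a multinomial coefficient, built up one factor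
  \<open>m!\<close> at a time.\<close>

lemma fact_power_le_fact_mult: "(fact m :: real) ^ q \<le> fact (m * q)"
proof (induction q)
  case (Suc q)
  have "fact m * fact (m * q) dvd (fact (m + m * q) :: nat)" by (rule fact_fact_dvd_fact)
  hence "fact m * fact (m * q) \<le> (fact (m + m * q) :: nat)" by (rule dvd_imp_le) simp
  hence "real (fact m * fact (m * q)) \<le> real (fact (m + m * q))" by (rule of_nat_mono)
  hence "fact m * fact (m * q) \<le> (fact (m + m * q) :: real)" by simp
  moreover have "fact m * fact m ^ q \<le> fact m * (fact (m * q) :: real)"
    using Suc.IH by (intro mult_left_mono) auto
  ultimately have "fact m * fact m ^ q \<le> (fact (m + m * q) :: real)" by (rule order.trans[rotated])
  thus ?case by simp
qed simp

lemma q_const_pos: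
  assumes "r \<ge> 2"
  shows "q_const r > 0"
proof -
  \<comment> \<open>\<open>5^2 = 8 * 2 + 9\<close>, so \<open>r = 2\<close> is exactly where the
    quantity under the floor reaches 1.\<close>
  have "sqrt (5\<^sup>2) \<le> sqrt (8 * real r + 9)" using assms by (intro real_sqrt_le_mono) simp
  hence "1 \<le> (sqrt (8 * real r + 9) - 3) / 2" by simp
  thus ?thesis unfolding q_const_def by linarith
qed

text \<open>For the noise moment \<open>D\<close> one has \<open>D^2 \<le> (2r)!\<close>, hence
  \<open>D^(2q) \<le> ((2r)!)^q \<le> (2rq)!\<close>; the root of order \<open>4q\<close> gives
  \<open>sqrt D\<close> on the left and \<open>gamma_const r\<close> on the right.\<close>

lemma sqrt_noise_moment_le_gamma:
  assumes "r \<ge> 2"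
  shows "sqrt (fact (2 * r) / (2 ^ r * fact r)) \<le> gamma_const r"
proof -
  define q where "q = q_const r"
  define D :: real where "D = fact (2 * r) / (2 ^ r * fact r)"
  have q: "q > 0" unfolding q_def using q_const_pos[OF assms] .
  have D: "D > 0" unfolding D_def by simp
  have "D\<^sup>2 \<le> fact (2 * r)"
    using mult_left_mono[OF fact_double_le[of r], of "fact (2 * r)"]
    by (simp add: D_def power_divide divide_le_eq power2_eq_square mult_ac)
  hence "(D\<^sup>2) ^ q \<le> fact (2 * r) ^ q" by (intro power_mono) auto
  also have "\<dots> \<le> fact (2 * r * q)" by (rule fact_power_le_fact_mult)
  finally have "D ^ (2 * q) \<le> fact (2 * r * q)" by (simp add: power_mult)
  hence "(D ^ (2 * q)) powr (1 / (4 * real q)) \<le> fact (2 * r * q) powr (1 / (4 * real q))"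
    using D by (intro powr_mono2) auto
  also have "(D ^ (2 * q)) powr (1 / (4 * real q)) = sqrt D"
    using D q by (simp add: powr_realpow[symmetric] powr_powr powr_half_sqrt)
  finally show ?thesis unfolding gamma_const_def D_def q_def .
qed

text \<open>Positive \<open>n\<close> matters at \<open>x = 0\<close>, where
  \<open>0 powr 0 = 0\<close> but \<open>0 ^ 0 = 1\<close>.\<close>

lemma powr_of_nat_eq_power:
  fixes x :: real
  assumes "x \<ge> 0" "n > 0"
  shows "x powr real n = x ^ n"
  using assms by (cases "x = 0") (auto simp: powr_realpow)

text \<open>Finiteness of the nonnegative integral yields integrability, which rules out the
  infinite branch of \<open>Lq_norm\<close> before values are compared.\<close>

lemma Lq_norm_2_le:
  assumes [measurable]: "Z \<in> borel_measurable M"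
    and le: "(\<integral>\<^sup>+\<omega>. ennreal ((Z \<omega>)\<^sup>2) \<partial>M) \<le> ennreal (b\<^sup>2)" and b: "b \<ge> 0"
  shows "Lq_norm M Z 2 \<le> ereal b"
proof -
  have p: "\<bar>z\<bar> powr 2 = z\<^sup>2" for z :: real
    using powr_of_nat_eq_power[of "\<bar>z\<bar>" 2] by simp
  have int: "integrable M (\<lambda>\<omega>. (Z \<omega>)\<^sup>2)"
    using le by (intro integrableI_bounded) (auto simp: le_less_trans)
  have "ennreal (\<integral>\<omega>. (Z \<omega>)\<^sup>2 \<partial>M) \<le> ennreal (b\<^sup>2)"
    using le int by (subst nn_integral_eq_integral[symmetric]) auto
  hence "(\<integral>\<omega>. (Z \<omega>)\<^sup>2 \<partial>M) \<le> b\<^sup>2" by (simp add: ennreal_le_iff)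
  hence "sqrt (\<integral>\<omega>. (Z \<omega>)\<^sup>2 \<partial>M) \<le> sqrt (b\<^sup>2)" by (rule real_sqrt_le_mono)
  thus ?thesis using int b by (simp add: Lq_norm_def p powr_half_sqrt)
qed

theorem theorem6p1:
  fixes M :: "'a measure" and X N :: "'a \<Rightarrow> real" and r :: nat
  assumes "prob_space M"
    and "X \<in> borel_measurable M" and "integrable M X"
    and "distributed M lborel N std_normal_density"
    and "prob_space.indep_var M borel X borel N"
    and "r \<ge> 2"
  shows "Lq_norm M (\<lambda>\<omega>. (deriv ^^ (r - 1)) (cond_mean M X) (X \<omega> + N \<omega>)) 2
         \<le> ereal (2 ^ r * C_const r)
            * min (ereal (gamma_const r)) ((Lq_norm M X (real (2 * r * q_const r))) ^ r)"
proof -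
  interpret prob_space M by fact
  interpret gaussian_channel M X N by unfold_locales fact+
  note r = \<open>r \<ge> 2\<close>
  define F where "F = (\<lambda>\<omega>. (deriv ^^ (r - 1)) (cond_mean M X) (X \<omega> + N \<omega>))"
  define K where "K = 2 ^ r * C_const r"
  define q where "q = q_const r"
  have K: "K \<ge> 0" unfolding K_def using C_const_nonneg by simp
  have q: "q > 0" unfolding q_def using q_const_pos[OF r] .
  have F [measurable]: "F \<in> borel_measurable M" unfolding F_def by measurable
  \<comment> \<open>The common reduction for both terms of the minimum: a bound \<open>b^2\<close>
    on the mean of \<open>\<bar>X - c(Y)\<bar>^(2r)\<close> bounds the norm by
    \<open>K * b\<close>.\<close>
  have F_le: "Lq_norm M F 2 \<le> ereal (K * b)"
    if b: "b \<ge> 0" "(\<integral>\<^sup>+\<omega>. ennreal (\<bar>X \<omega> - c (X \<omega> + N \<omega>)\<bar> ^ (2 * r)) \<partial>M) \<le> ennreal (b\<^sup>2)"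
      and c: "c \<in> borel_measurable borel" for b c
  proof (rule Lq_norm_2_le)
    have "(\<integral>\<^sup>+\<omega>. ennreal ((F \<omega>)\<^sup>2) \<partial>M)
       \<le> ennreal ((C_const r * 2 ^ r)\<^sup>2) * (\<integral>\<^sup>+\<omega>. ennreal (\<bar>X \<omega> - c (X \<omega> + N \<omega>)\<bar> ^ (2 * r)) \<partial>M)"
      unfolding F_def by (rule nn_integral_deriv_cond_mean_square_le[OF r c])
    also have "\<dots> \<le> ennreal ((C_const r * 2 ^ r)\<^sup>2) * ennreal (b\<^sup>2)"
      by (intro mult_left_mono b) simp
    also have "\<dots> = ennreal ((K * b)\<^sup>2)"
      by (simp add: ennreal_mult[symmetric] power_mult_distrib K_def mult.commute)
    finally show "(\<integral>\<^sup>+\<omega>. ennreal ((F \<omega>)\<^sup>2) \<partial>M) \<le> ennreal ((K * b)\<^sup>2)" .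
  qed (use b K in auto)
  have noise: "Lq_norm M F 2 \<le> ereal (K * gamma_const r)"
  proof -
    let ?b = "sqrt (fact (2 * r) / (2 ^ r * fact r))"
    have "Lq_norm M F 2 \<le> ereal (K * ?b)"
      using nn_integral_noise_moment[of r] by (intro F_le[of ?b "\<lambda>y. y"]) auto
    also have "\<dots> \<le> ereal (K * gamma_const r)"
      using K sqrt_noise_moment_le_gamma[OF r] by (simp add: mult_left_mono)
    finally show ?thesis .
  qed
  have signal: "Lq_norm M F 2 \<le> ereal K * (Lq_norm M X (real (2 * r * q))) ^ r"
    if int: "integrable M (\<lambda>\<omega>. \<bar>X \<omega>\<bar> powr real (2 * r * q))"
  proof -
    have p: "\<bar>X \<omega>\<bar> powr real (2 * r * q) = \<bar>X \<omega>\<bar> ^ (2 * r * q)" for \<omega>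
      using r q by (intro powr_of_nat_eq_power) auto
    have int': "integrable M (\<lambda>\<omega>. \<bar>X \<omega>\<bar> ^ (2 * r * q))" using int unfolding p .
    define B where "B = expectation (\<lambda>\<omega>. \<bar>X \<omega>\<bar> ^ (2 * r))"
    define E where "E = expectation (\<lambda>\<omega>. \<bar>X \<omega>\<bar> ^ (2 * r * q))"
    have B0: "B \<ge> 0" unfolding B_def by simp
    have int2: "integrable M (\<lambda>\<omega>. \<bar>X \<omega>\<bar> ^ (2 * r))"
      using integrable_power_mono[OF X_measurable int'] q by simp
    have BE: "B ^ q \<le> E" unfolding B_def E_def
      by (rule expectation_power_le[OF X_measurable int' q])
    have "Lq_norm M F 2 \<le> ereal (K * sqrt B)"
    proof (rule F_le[of "sqrt B" "\<lambda>_. 0"])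
      show "(\<integral>\<^sup>+\<omega>. ennreal (\<bar>X \<omega> - 0\<bar> ^ (2 * r)) \<partial>M) \<le> ennreal ((sqrt B)\<^sup>2)"
        using int2 B0 by (subst nn_integral_eq_integral) (auto simp: B_def)
    qed (use B0 in auto)
    \<comment> \<open>The exponent is arranged so that Jensen's \<open>B^q \<le> E\<close> can be
      inserted; for \<open>B = 0\<close> both sides are 0 because \<open>q > 0\<close>.\<close>
    also have "sqrt B = (B ^ q) powr (1 / (2 * real q))"
    proof (cases "B = 0")
      case False
      thus ?thesis using B0 q by (simp add: powr_realpow[symmetric] powr_powr powr_half_sqrt)
    qed (use q in simp)
    also have "ereal (K * (B ^ q) powr (1 / (2 * real q))) \<le> ereal (K * E powr (1 / (2 * real q)))"
      using BE B0 K by (auto intro!: mult_left_mono powr_mono2)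
    \<comment> \<open>Since \<open>1 / (2q) = r / (2rq)\<close>, this root of the moment is the
      \<open>r\<close>-th power of the norm of order \<open>2rq\<close>.\<close>
    also have "E powr (1 / (2 * real q)) = (E powr (1 / real (2 * r * q))) ^ r"
    proof -
      have "(E powr (1 / real (2 * r * q))) ^ r = (E powr (1 / real (2 * r * q))) powr real r"
        using r by (intro powr_of_nat_eq_power[symmetric]) auto
      also have "\<dots> = E powr (1 / (2 * real q))" using r by (simp add: powr_powr)
      finally show ?thesis by simp
    qed
    also have "ereal (K * (E powr (1 / real (2 * r * q))) ^ r) = ereal K * (Lq_norm M X (real (2 * r * q))) ^ r"
      using int' by (simp only: Lq_norm_def p E_def[symmetric] if_True ereal_power times_ereal.simps)
    finally show ?thesis .
  qed
  show ?thesis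
  proof (cases "integrable M (\<lambda>\<omega>. \<bar>X \<omega>\<bar> powr real (2 * r * q))")
    case True
    thus ?thesis using noise signal[OF True]
      unfolding F_def[symmetric] K_def[symmetric] q_def[symmetric] by (simp add: min_def)
  next
    case False
    \<comment> \<open>An infinite norm has an infinite \<open>r\<close>-th power as
      \<open>r > 0\<close>, so the minimum is \<open>gamma_const r\<close>.\<close>
    hence "Lq_norm M X (real (2 * r * q)) = \<infinity>" by (simp add: Lq_norm_def)
    thus ?thesis using noise r
      unfolding F_def[symmetric] K_def[symmetric] q_def[symmetric] by simp
  qed
qed

end
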